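(* Let $d\ge 1$, $0<\alpha\le 1/2$ and $0<\eta\le 1$. Suppose $\mu$ is a mean $(\alpha,\eta)$-porous Borel probability measure on $\mathbb{R}^d$. Then \[ \dim_P(\mu)\le d - c_d\cdot \eta\cdot \alpha^d,\qquad\text{where}\qquad c_d = \frac{2}{5\,\log 2\cdot 2^{4d}\cdot d^{d/2}}, \] and $\dim_P(\mu)$ is the (upper) packing dimension of $\mu$.
   Context: $\log$ is the natural logarithm, $B(x,r)$ is the closed Euclidean ball of centre $x$ and radius $r$, and $[n]=\{0,\ldots,n-1\}$. For a Borel probability measure $\mu$ on $\mathbb{R}^d$, $x\in\operatorname{supp}\mu$, $r>0$ and $\varepsilon\ge 0$, define \[ \operatorname{por}(\mu,x,r,\varepsilon)=\sup\left\{\alpha\ge 0:\ \inf_{B(y,\alpha r)\subset B(x,r)}\frac{\mu(B(y,\alpha r))}{\mu(B(x,r))}\le\varepsilon\right\}, \] where the infimum is over all $y$ with $B(y,\alpha r)\subset B(x,r)$. For $0<\alpha\le 1/2$, $0<\eta\le 1$ and $0\le\varepsilon<1$, $\mu$ is mean $(\alpha,\eta,\varepsilon)$-porous if \[ \liminf_{n\to\infty}\frac1n\left|\{i\in[n]:\operatorname{por}(\mu,x,2^{-i},\varepsilon)\ge\alpha\}\right|\ge\eta \] for $\mu$-almost every $x$. $\mu$ is mean $(\alpha,\eta)$-porous if it is mean $(\alpha,\eta,\varepsilon)$-porous for all $\varepsilon>0$ (with $\varepsilon<1$). The (upper) packing dimension of $\mu$ is the $\mu$-essential supremum over $x$ of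 the upper local dimension $\limsup_{r\to0}\frac{\log\mu(B(x,r))}{\log r}$. *)

theory Defs
  imports "HOL-Probability.Probability"
begin

text \<open>
  All extended-real valued notions live in \<^typ>\<open>ereal\<close>. In \<open>por\<close> this matters for the
  infimum: for \<open>\<alpha> > 1\<close> no ball of radius \<open>\<alpha> * r\<close> fits into \<open>cball x r\<close>, the infimum over
  the empty family is \<open>\<infinity>\<close>, and such \<open>\<alpha>\<close> does not contribute to the supremum.
  Points \<open>x\<close> outside the support of \<open>\<mu>\<close> (where \<open>\<mu> (cball x r)\<close> may be \<open>0\<close>) form a \<open>\<mu>\<close>-null
  set; the values of \<open>por\<close> and \<open>upper_local_dim\<close> there are irrelevant.
\<close>

definition por :: "'a::euclidean_space measure \<Rightarrow> 'a \<Rightarrow> real \<Rightarrow> real \<Rightarrow> ereal" where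
  "por \<mu> x r \<epsilon> =
     (SUP \<alpha> \<in> {\<alpha>::real. 0 \<le> \<alpha> \<and>
        (INF y \<in> {y. cball y (\<alpha> * r) \<subseteq> cball x r}.
           ereal (measure \<mu> (cball y (\<alpha> * r)) / measure \<mu> (cball x r))) \<le> ereal \<epsilon>}.
      ereal \<alpha>)"

definition mean_porous_eps ::
    "real \<Rightarrow> real \<Rightarrow> real \<Rightarrow> 'a::euclidean_space measure \<Rightarrow> bool" where
  "mean_porous_eps \<alpha> \<eta> \<epsilon> \<mu> \<longleftrightarrow>
     (AE x in \<mu>. ereal \<eta> \<le>
        liminf (\<lambda>n. ereal (real (card {i \<in> {..<n}. ereal \<alpha> \<le> por \<mu> x (1 / 2 ^ i) \<epsilon>}) / real n)))"

definition mean_porous :: "real \<Rightarrow> real \<Rightarrow> 'a::euclidean_space measure \<Rightarrow> bool" where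
  "mean_porous \<alpha> \<eta> \<mu> \<longleftrightarrow> (\<forall>\<epsilon>. 0 < \<epsilon> \<and> \<epsilon> < 1 \<longrightarrow> mean_porous_eps \<alpha> \<eta> \<epsilon> \<mu>)"

definition upper_local_dim :: "'a::euclidean_space measure \<Rightarrow> 'a \<Rightarrow> ereal" where
  "upper_local_dim \<mu> x =
     Limsup (at_right 0) (\<lambda>r. ereal (ln (measure \<mu> (cball x r)) / ln r))"

text \<open>
  \<open>esssup\<close> is \<open>\<infinity>\<close> by convention for non-measurable functions. This convention does not
  interfere: the upper local dimension of a finite Borel measure is a Borel function.
\<close>

definition packing_dim :: "'a::euclidean_space measure \<Rightarrow> ereal" where
  "packing_dim \<mu> = esssup \<mu> (upper_local_dim \<mu>)"

definition porosity_const :: "nat \<Rightarrow> real" where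
  "porosity_const d = 2 / (5 * ln 2 * 2 ^ (4 * d) * real d powr (real d / 2))"

end

theory Submission
  imports Defs
begin

text \<open>
  A dyadic cube of side \<open>2 ^ - n\<close> that contains \<open>x\<close> lies in a ball about \<open>x\<close> of comparable radius, so
  it suffices to bound the mass of the cube from below by \<open>exp (- n * \<xi>)\<close>, for almost every \<open>x\<close> and all
  large \<open>n\<close>, with \<open>\<xi>\<close> slightly smaller than \<open>ln 2\<close> times the claimed dimension bound.

  The tool for this is a gambler who distributes a unit of capital over the cubes, dividing
  the capital of a cube among its children in any way. The cubes of generation \<open>n\<close> whose mass is
  less than \<open>exp (- t * n)\<close> times their capital have total mass at most \<open>exp (- t * n)\<close>, so by
  Borel-Cantelli almost every point eventually leaves them (lemma \<open>betting\<close>). Equal division gives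
  every \<open>\<xi> > d * ln 2\<close>. Porosity is used to divide better. Suppose that a cube \<open>Q\<close> has a
  descendant \<open>k\<close> generations below it, of relative volume \<open>p ^ k\<close> with \<open>p = 2 ^ - d\<close>, which
  carries almost no mass. Betting against this hole along the path from \<open>Q\<close> to it earns a constant
  multiple of \<open>p ^ k\<close>, unless the point falls into the hole. A cube may lie on the paths to the holes
  of \<open>k\<close> ancestors, and these \<open>k\<close> bets are combined into one by a geometric
  mean. Equal weights \<open>1 / k\<close> would lose the factor \<open>k\<close>, which is of order \<open>ln (1 / \<alpha>)\<close>;
  geometrically decaying weights lose only a constant (lemmas \<open>hole_bet\<close> and
  \<open>potential_step\<close>). That a point falls into such holes rarely needs no probability: each such event
  multiplies the mass of the surrounding cube by a tiny factor over \<open>k\<close> generations, and a crude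
  exponential lower bound for the mass leaves no room for many of them (lemma \<open>count_drops\<close>).

  It remains to find the holes. If \<open>x\<close> is porous at scale \<open>2 ^ - i\<close>, with hole centre \<open>y\<close>, there is
  an almost empty cube around \<open>y\<close>, but \<open>x\<close> and \<open>y\<close> may lie in different cubes of
  side \<open>\<theta> * 2 ^ - i\<close>. The grid is therefore translated by all vectors with coordinates in
  \<open>\<theta> / N * {0, ..., N - 1}\<close>, for a fixed odd \<open>N\<close>. As 2 is invertible modulo \<open>N\<close>, in every generation these
  shifts are equidistributed modulo the grid, and at least the fraction
  \<open>(1 - 1 / \<theta> - 1 / N) ^ d\<close> of them puts \<open>x\<close> and \<open>y\<close> into one cube (lemma \<open>many_shifts\<close>).
  The lower bounds for the logarithm of the mass of a ball that come from the different shifts are averaged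
  for each \<open>n\<close> separately, so no law of large numbers for random grids is needed (lemma
  \<open>mass_lower_bound\<close>).

  For the constant: the hole has side \<open>\<theta> * 2 ^ - (i + k) = \<alpha>' * 2 ^ - i / sqrt d\<close> with \<open>\<alpha>'\<close> just
  below \<open>\<alpha>\<close>, and \<open>\<theta>\<close> can be taken in the interval from \<open>3 / 2\<close> to \<open>3\<close>. The product of \<open>p ^ k\<close> and the
  fraction of good shifts is then about \<open>(\<alpha> / sqrt d) ^ d\<close> times the \<open>d\<close>-th power of
  \<open>(1 / \<theta>) * (1 - 1 / \<theta>) \<ge> 2 / 9\<close>, and the weights contribute
  \<open>(1 - sqrt p)\<^sup>2 / \<kappa>\<close>. For \<open>d = 1\<close> this beats \<open>2 / 5 / 16\<close> by less than two percent, which is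
  why \<open>\<kappa> = 3 / 4\<close> is used in that case and \<open>\<kappa> = 1\<close> in all others.
\<close>

section \<open>Betting on a tree of cells\<close>

text \<open>
  The combinatorics of dyadic cubes without their geometry; \<open>cell n x\<close> is the cube of generation \<open>n\<close>
  around \<open>x\<close>. Countability of the roots allows to prove almost sure statements below each root separately,
  where every generation is finite.
\<close>
locale partition_tree = prob_space M for M :: "'a measure" +
  fixes cell :: "nat \<Rightarrow> 'a \<Rightarrow> 'a set" and D :: nat
  assumes cell_sets [measurable]: "cell n x \<in> sets M"
    and cell_self: "x \<in> cell n x"
    and cell_eq: "y \<in> cell n x \<Longrightarrow> cell n y = cell n x"
    and cell_Suc: "cell (Suc n) x \<subseteq> cell n x"
    and countable_roots: "countable (range (cell 0))"
    and finite_children: "finite (cell (Suc n) ` cell n x)"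
    and card_children: "card (cell (Suc n) ` cell n x) \<le> D"
begin

lemma cell_antimono: "m \<le> n \<Longrightarrow> cell n x \<subseteq> cell m x"
  by (rule lift_Suc_antimono_le[of "\<lambda>n. cell n x"]) (use cell_Suc in auto)

lemma cell_some: "(SOME z. z \<in> cell n x) \<in> cell n x"
  using cell_self by (rule someI)

lemma descendants_Suc:
  "cell (Suc n) ` cell 0 x = (\<Union>Q\<in>cell n ` cell 0 x. cell (Suc n) ` Q)"
proof -
  have "y \<in> cell 0 x" if "z \<in> cell 0 x" "y \<in> cell n z" for y z
    using cell_antimono[of 0 n z] cell_eq[OF that(1)] that(2) by auto
  then show ?thesis using cell_self by (auto 5 3 simp: image_iff)
qed

lemma finite_descendants: "finite (cell n ` cell 0 x)"
proof (induction n)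
  case 0
  have "cell 0 ` cell 0 x \<subseteq> {cell 0 x}" using cell_eq by auto
  then show ?case by (rule finite_subset) simp
next
  case (Suc n)
  show ?case unfolding descendants_Suc
    using Suc finite_children by (intro finite_UN_I) auto
qed

lemma D_pos: "0 < D"
proof -
  have "cell (Suc 0) ` cell 0 x \<noteq> {}" for x using cell_self by auto
  then have "0 < card (cell (Suc 0) ` cell 0 undefined)"
    using finite_children card_gt_0_iff by blast
  then show ?thesis using card_children[of 0 undefined] by linarith
qed

lemma bet_prod_cell:
  assumes bet_cell: "\<And>n x y. y \<in> cell (Suc n) x \<Longrightarrow> f n y = f n x"
    and y: "y \<in> cell n x"
  shows "(\<Prod>m<n. f m y) = (\<Prod>m<n. f m x :: real)"
proof (rule prod.cong[OF refl])
  fix m assume "m \<in> {..<n}"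
  then have "y \<in> cell (Suc m) x" using cell_antimono[of "Suc m" n x] y by auto
  then show "f m y = f m x" by (rule bet_cell)
qed

text \<open>
  A bet \<open>f n\<close> is a function of the point that is constant on the cells of generation \<open>n + 1\<close>; its
  value there is the share of the capital of the parent that the child receives. Thus the product of the bets
  is the capital on the current cell, and below a root cell it never sums to more than 1.
\<close>
lemma bet_sum_le_1:
  assumes bet_nonneg: "\<And>n x. 0 \<le> f n x"
    and bet_cell: "\<And>n x y. y \<in> cell (Suc n) x \<Longrightarrow> f n y = f n x"
    and bet_sum: "\<And>n x. (\<Sum>C\<in>cell (Suc n) ` cell n x. f n (SOME y. y \<in> C)) \<le> (1::real)"
  shows "(\<Sum>C\<in>cell n ` cell 0 x. \<Prod>m<n. f m (SOME y. y \<in> C)) \<le> 1"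
proof (induction n)
  case 0
  have "cell 0 ` cell 0 x = {cell 0 x}" using cell_eq[of _ 0 x] cell_self[of x 0] by blast
  then show ?case by simp
next
  case (Suc n)
  have bet_prod_const: "(\<Prod>m<n. f m y) = (\<Prod>m<n. f m x)" if "y \<in> cell n x" for n x y
    by (rule bet_prod_cell[OF _ that]) (rule bet_cell)
  have "(\<Sum>C\<in>cell (Suc n) ` cell 0 x. \<Prod>m<Suc n. f m (SOME y. y \<in> C))
      = (\<Sum>Q\<in>cell n ` cell 0 x. \<Sum>C\<in>cell (Suc n) ` Q. \<Prod>m<Suc n. f m (SOME y. y \<in> C))"
    unfolding descendants_Suc
  proof (rule sum.UNION_disjoint)
    show "finite (cell n ` cell 0 x)" by (rule finite_descendants)
    show "\<forall>Q\<in>cell n ` cell 0 x. finite (cell (Suc n) ` Q)" using finite_children by auto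
    show "\<forall>Q\<in>cell n ` cell 0 x. \<forall>Q'\<in>cell n ` cell 0 x. Q \<noteq> Q' \<longrightarrow>
        cell (Suc n) ` Q \<inter> cell (Suc n) ` Q' = {}"
    proof (intro ballI impI equals0I)
      fix Q Q' C assume Q: "Q \<in> cell n ` cell 0 x" "Q' \<in> cell n ` cell 0 x" "Q \<noteq> Q'"
        and "C \<in> cell (Suc n) ` Q \<inter> cell (Suc n) ` Q'"
      then obtain u v where uv: "u \<in> Q" "v \<in> Q'" "cell (Suc n) u = cell (Suc n) v" by auto
      then have "cell n u = cell n v"
        using cell_eq[of u n v] cell_self[of u "Suc n"] cell_Suc[of n v] by auto
      moreover have "cell n u = Q" "cell n v = Q'" using Q uv cell_eq by auto
      ultimately show False using Q by simp
    qed
  qed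
  also have "\<dots> \<le> (\<Sum>Q\<in>cell n ` cell 0 x. \<Prod>m<n. f m (SOME y. y \<in> Q))"
  proof (rule sum_mono)
    fix Q assume "Q \<in> cell n ` cell 0 x"
    then obtain u where u: "Q = cell n u" by auto
    define F where "F = (\<Prod>m<n. f m (SOME y. y \<in> Q))"
    have "0 \<le> F" unfolding F_def by (intro prod_nonneg) (auto simp: bet_nonneg)
    have "(\<Prod>m<Suc n. f m (SOME y. y \<in> C)) = F * f n (SOME y. y \<in> C)"
      if "C \<in> cell (Suc n) ` Q" for C
    proof -
      from that obtain v where v: "v \<in> Q" "C = cell (Suc n) v" by auto
      have "(SOME y. y \<in> C) \<in> cell n v" using cell_some[of "Suc n" v] cell_Suc[of n v] v by auto
      then have "(SOME y. y \<in> C) \<in> Q" using v u cell_eq by auto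
      moreover have "(SOME y. y \<in> Q) \<in> Q" using cell_some u by auto
      ultimately have "(\<Prod>m<n. f m (SOME y. y \<in> C)) = F"
        unfolding F_def u using bet_prod_const u by metis
      then show ?thesis by simp
    qed
    then have "(\<Sum>C\<in>cell (Suc n) ` Q. \<Prod>m<Suc n. f m (SOME y. y \<in> C))
        = F * (\<Sum>C\<in>cell (Suc n) ` Q. f n (SOME y. y \<in> C))"
      unfolding sum_distrib_left by (intro sum.cong refl)
    also have "\<dots> \<le> F * 1" unfolding u by (intro mult_left_mono bet_sum \<open>0 \<le> F\<close>)
    finally show "(\<Sum>C\<in>cell (Suc n) ` Q. \<Prod>m<Suc n. f m (SOME y. y \<in> C)) \<le> F" by simp
  qed
  also have "\<dots> \<le> 1" by (rule Suc)
  finally show ?case .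
qed

text \<open>
  The cells of generation \<open>n\<close> in which the inequality fails have masses below
  \<open>exp (- t * n)\<close> times their capitals. The capitals sum to at most 1 below each root cell, so the failures
  have summable mass and Borel-Cantelli applies. Working below one root cell at a time keeps all sums
  finite.
\<close>
lemma betting:
  assumes bet_nonneg: "\<And>n x. 0 \<le> f n x"
    and bet_cell: "\<And>n x y. y \<in> cell (Suc n) x \<Longrightarrow> f n y = f n x"
    and bet_sum: "\<And>n x. (\<Sum>C\<in>cell (Suc n) ` cell n x. f n (SOME y. y \<in> C)) \<le> (1::real)"
    and t: "0 < t"
  shows "AE x in M. eventually (\<lambda>n. exp (- t * real n) * (\<Prod>m<n. f m x) \<le> measure M (cell n x)) sequentially"
proof -
  have bet_prod_const: "(\<Prod>m<n. f m y) = (\<Prod>m<n. f m x)" if "y \<in> cell n x" for n x y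
    by (rule bet_prod_cell[OF _ that]) (rule bet_cell)
  define good where "good n x \<longleftrightarrow> exp (- t * real n) * (\<Prod>m<n. f m x) \<le> measure M (cell n x)" for n x
  have root: "AE x in M. x \<in> cell 0 z \<longrightarrow> eventually (\<lambda>n. good n x) sequentially" for z
  proof -
    define Bad where "Bad n = {C \<in> cell n ` cell 0 z. \<not> good n (SOME y. y \<in> C)}" for n
    have fin: "finite (Bad n)" for n unfolding Bad_def using finite_descendants by auto
    have Bad_sets: "C \<in> sets M" if "C \<in> Bad n" for C n using that unfolding Bad_def by auto
    have good_cell: "good n y = good n x" if "y \<in> cell n x" for n x y
      unfolding good_def bet_prod_const[OF that] cell_eq[OF that] ..
    have mem: "x \<in> \<Union>(Bad n)" if "x \<in> cell 0 z" "\<not> good n x" for n x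
    proof -
      have "cell n x \<in> Bad n"
        unfolding Bad_def using that good_cell[OF cell_some] by auto
      then show ?thesis using cell_self by blast
    qed
    have bound: "measure M (\<Union>(Bad n)) \<le> exp (- t * real n)" for n
    proof -
      have "measure M (\<Union>(Bad n)) = measure M (\<Union>C\<in>Bad n. C)" by simp
      also have "\<dots> \<le> (\<Sum>C\<in>Bad n. measure M C)"
        by (rule finite_measure_subadditive_finite) (use fin Bad_sets in auto)
      also have "\<dots> \<le> (\<Sum>C\<in>Bad n. exp (- t * real n) * (\<Prod>m<n. f m (SOME y. y \<in> C)))"
      proof (rule sum_mono)
        fix C assume C: "C \<in> Bad n"
        then obtain u where "C = cell n u" unfolding Bad_def by auto
        then have "cell n (SOME y. y \<in> C) = C" using cell_some cell_eq by auto
        then show "measure M C \<le> exp (- t * real n) * (\<Prod>m<n. f m (SOME y. y \<in> C))"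
          using C unfolding Bad_def good_def by auto
      qed
      also have "\<dots> \<le> (\<Sum>C\<in>cell n ` cell 0 z. exp (- t * real n) * (\<Prod>m<n. f m (SOME y. y \<in> C)))"
        by (rule sum_mono2) (use finite_descendants bet_nonneg in \<open>auto simp: Bad_def intro!: mult_nonneg_nonneg prod_nonneg\<close>)
      also have "\<dots> \<le> exp (- t * real n) * 1"
        unfolding sum_distrib_left[symmetric]
        by (intro mult_left_mono bet_sum_le_1 bet_nonneg bet_cell bet_sum) auto
      finally show ?thesis by simp
    qed
    have "summable (\<lambda>n. exp (- t) ^ n)" by (rule summable_geometric) (use t in auto)
    then have "summable (\<lambda>n. exp (- t * real n))"
      by (simp add: exp_of_nat_mult[symmetric] mult.commute)
    then have "summable (\<lambda>n. measure M (\<Union>(Bad n)))"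
      by (rule summable_comparison_test') (use bound in auto)
    then have "AE x in M. eventually (\<lambda>n. x \<in> space M - \<Union>(Bad n)) sequentially"
      by (intro borel_cantelli_AE1)
        (use fin Bad_sets in \<open>auto intro!: sets.finite_Union simp: emeasure_eq_measure\<close>)
    then show ?thesis
      by (rule AE_mp) (intro AE_I2 impI, elim eventually_mono, use mem in blast)
  qed
  have "AE x in M. \<forall>Q\<in>range (cell 0). x \<in> Q \<longrightarrow> eventually (\<lambda>n. good n x) sequentially"
    using root by (subst AE_ball_countable[OF countable_roots]) auto
  then show ?thesis unfolding good_def
    by (rule AE_mp) (intro AE_I2 impI, use cell_self in blast)
qed

end

section \<open>Betting against holes\<close>

text \<open>
  Jensen's inequality for \<open>exp\<close>, the missing weight being put on the value 0. It says that a weighted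
  geometric mean of bets, filled up with the neutral bet, is dominated by the arithmetic mean and hence
  is again a bet.
\<close>
lemma exp_weighted_le:
  fixes w e :: "nat \<Rightarrow> real"
  assumes w: "\<And>j. j < k \<Longrightarrow> 0 \<le> w j" "(\<Sum>j<k. w j) \<le> 1"
  shows "exp (\<Sum>j<k. w j * e j) \<le> (\<Sum>j<k. w j * exp (e j)) + (1 - (\<Sum>j<k. w j))"
proof -
  define s where "s = (\<Sum>j<k. w j * e j)"
  define W where "W = (\<Sum>j<k. w j)"
  have tangent: "exp s * (1 + (u - s)) \<le> exp u" for u :: real
    using mult_left_mono[OF exp_ge_add_one_self[of "u - s"], of "exp s"] by (simp add: exp_diff)
  have "exp s = (\<Sum>j<k. w j * (exp s * (1 + (e j - s)))) + (1 - W) * (exp s * (1 + (0 - s)))"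
  proof -
    have "(\<Sum>j<k. w j * (exp s * (1 + (e j - s)))) = (\<Sum>j<k. (exp s * (1 - s)) * w j + exp s * (w j * e j))"
      by (intro sum.cong refl) (simp add: algebra_simps)
    also have "\<dots> = exp s * (1 - s) * W + exp s * s"
      by (simp add: sum.distrib sum_distrib_left[symmetric] s_def W_def)
    finally show ?thesis by (simp add: algebra_simps)
  qed
  also have "\<dots> \<le> (\<Sum>j<k. w j * exp (e j)) + (1 - W) * exp 0"
    by (intro add_mono sum_mono mult_left_mono tangent w) (use w in \<open>auto simp: W_def\<close>)
  finally show ?thesis by (simp add: s_def W_def)
qed

text \<open>
  In generation \<open>m\<close> the bets of the ancestors in generations \<open>m - j\<close> are placed; regrouping the sum by the
  generation \<open>i = m - j\<close> of the ancestor collects what one hole earns in total.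
\<close>
lemma sum_by_start:
  fixes h :: "nat \<Rightarrow> nat \<Rightarrow> real"
  shows "(\<Sum>m<n. \<Sum>j<k. if j \<le> m then h j (m - j) else 0) = (\<Sum>i<n. \<Sum>j<min k (n - i). h j i)"
proof -
  have "(\<Sum>m<n. \<Sum>j<k. if j \<le> m then h j (m - j) else 0) = (\<Sum>j<k. \<Sum>m<n. if j \<le> m then h j (m - j) else 0)"
    by (rule sum.swap)
  also have "\<dots> = (\<Sum>j<k. \<Sum>i<n. if i + j < n then h j i else 0)"
  proof (rule sum.cong[OF refl])
    fix j
    have "(\<Sum>m<n. if j \<le> m then h j (m - j) else 0) = (\<Sum>m\<in>{m \<in> {..<n}. j \<le> m}. h j (m - j))"
      by (rule sum.inter_filter[symmetric]) simp
    also have "\<dots> = (\<Sum>i\<in>{i \<in> {..<n}. i + j < n}. h j i)"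
      by (rule sum.reindex_bij_witness[of _ "\<lambda>i. i + j" "\<lambda>m. m - j"]) auto
    also have "\<dots> = (\<Sum>i<n. if i + j < n then h j i else 0)"
      by (rule sum.inter_filter) simp
    finally show "(\<Sum>m<n. if j \<le> m then h j (m - j) else 0) = \<dots>" .
  qed
  also have "\<dots> = (\<Sum>i<n. \<Sum>j<k. if i + j < n then h j i else 0)"
    by (rule sum.swap)
  also have "\<dots> = (\<Sum>i<n. \<Sum>j<min k (n - i). h j i)"
  proof (rule sum.cong[OF refl])
    fix i
    have "(\<Sum>j<k. if i + j < n then h j i else 0) = (\<Sum>j\<in>{j \<in> {..<k}. i + j < n}. h j i)"
      by (rule sum.inter_filter[symmetric]) simp
    also have "{j \<in> {..<k}. i + j < n} = {..<min k (n - i)}" by auto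
    finally show "(\<Sum>j<k. if i + j < n then h j i else 0) = (\<Sum>j<min k (n - i). h j i)" .
  qed
  finally show ?thesis .
qed

lemma sum_if_const: "finite A \<Longrightarrow> (\<Sum>i\<in>A. if P i then c else 0) = c * real (card {i \<in> A. P i})"
  by (subst sum.inter_filter[symmetric]) (auto simp: mult.commute)

context partition_tree
begin

text \<open>
  A cell of generation \<open>i\<close> with \<open>G i x\<close> has as hole the cell of generation \<open>i + k\<close>
  around the point \<open>c i x\<close>. As long as a point follows the path to the hole, the child on the path is
  given \<open>exp (- T (j + 1) / w j)\<close> times the share of each sibling in step \<open>j\<close>, and this bet enters the
  geometric mean with the exponent \<open>w j\<close>. The number \<open>T j\<close> is a potential: it is the logarithmic profit that a point on the path after \<open>j\<close> steps
  can still count on, and it drops to 0 once the point has left the path. The assumption on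
  \<open>T\<close> says that each step earns at least the loss of potential, whichever child is entered. Hence the hole
  earns \<open>T 0\<close>, minus the final potential \<open>T k\<close> if the point ends up in the hole. The extra
  \<open>k\<close> in the conclusion accounts for the holes of the last \<open>k\<close> generations, whose game is not over at
  time \<open>n\<close>.
\<close>
lemma hole_bet:
  fixes w T :: "nat \<Rightarrow> real" and G :: "nat \<Rightarrow> 'a \<Rightarrow> bool" and c :: "nat \<Rightarrow> 'a \<Rightarrow> 'a"
  assumes w: "\<And>j. j < k \<Longrightarrow> 0 < w j" "(\<Sum>j<k. w j) \<le> 1"
    and T: "\<And>j. j < k \<Longrightarrow> T j \<le> w j * - ln (1 - 1 / real D + exp (- T (Suc j) / w j) / real D)"
    and T_le: "\<And>j. j \<le> k \<Longrightarrow> 0 \<le> T j \<and> T j \<le> T k"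
    and G_cell: "\<And>i x y. y \<in> cell i x \<Longrightarrow> G i y = G i x"
    and c_cell: "\<And>i x y. y \<in> cell i x \<Longrightarrow> c i y = c i x"
    and c_mem: "\<And>i x. G i x \<Longrightarrow> c i x \<in> cell i x"
    and t: "0 < t"
  shows "AE x in M. eventually (\<lambda>n.
           exp (- (ln (real D) + t) * real n + T 0 * real (card {i \<in> {..<n}. G i x})
             - T k * (real (card {i \<in> {..<n}. G i x \<and> c i x \<in> cell (i + k) x}) + real k))
           \<le> measure M (cell n x)) sequentially"
proof -
  \<comment> \<open>\<open>hit i m x\<close>: at generation \<open>m\<close> the point \<open>x\<close> is still on the path from its cell of generation
    \<open>i\<close> to the hole of that cell. \<open>Z j\<close> normalises the shares of step \<open>j\<close>, and \<open>gain j i x\<close> is the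
    logarithm of the share of the child entered, relative to the equal share.\<close>
  define hit where "hit i m x \<longleftrightarrow> G i x \<and> c i x \<in> cell m x" for i m x
  define v where "v j = T (Suc j) / w j" for j
  define Z where "Z j = 1 - 1 / real D + exp (- v j) / real D" for j
  define gain where "gain j i x =
    (if hit i (i + j) x then (if hit i (Suc (i + j)) x then - v j else 0) - ln (Z j) else 0)" for j i x
  define e where "e m j x = (if j \<le> m then gain j (m - j) x else 0)" for m j x
  define f where "f m x = exp (\<Sum>j<k. w j * e m j x) / real D" for m x
  have D1: "1 \<le> real D" using D_pos by simp
  have Z_pos: "0 < Z j" for j
  proof -
    have "0 < exp (- v j) / real D" using D1 by simp
    moreover have "0 \<le> 1 - 1 / real D" using D1 by simp
    ultimately show ?thesis unfolding Z_def by linarith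
  qed
  have hit_cell: "hit i m y = hit i m x" if "y \<in> cell m x" "i \<le> m" for i m x y
  proof -
    have "y \<in> cell i x" using cell_antimono[OF that(2)] that(1) by auto
    then show ?thesis unfolding hit_def using G_cell c_cell cell_eq[OF that(1)] by metis
  qed
  have hit_mono: "hit i m x" if "hit i n x" "m \<le> n" for i m n x
    using that cell_antimono[of m n x] unfolding hit_def by auto
  have e_cell: "e m j y = e m j x" if "y \<in> cell (Suc m) x" for m j x y
  proof -
    have "y \<in> cell m x" using that cell_Suc by auto
    then show ?thesis unfolding e_def gain_def
      using hit_cell[OF that, of "m - j"] hit_cell[of y m x "m - j"] by auto
  qed
  \<comment> \<open>If the cell lies on the path, exactly one of its at most \<open>D\<close> children stays on it.\<close>
  have sum_e: "(\<Sum>C\<in>cell (Suc m) ` cell m x. exp (e m j (SOME y. y \<in> C))) \<le> real D" for m j x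
  proof -
    define S where "S = cell (Suc m) ` cell m x"
    have S: "finite S" "real (card S) \<le> real D"
      unfolding S_def using finite_children card_children by auto
    have rep: "cell (Suc m) (SOME y. y \<in> C) = C" "(SOME y. y \<in> C) \<in> cell m x" if "C \<in> S" for C
    proof -
      from that obtain u where u: "C = cell (Suc m) u" "u \<in> cell m x" unfolding S_def by auto
      show "cell (Suc m) (SOME y. y \<in> C) = C" using cell_some cell_eq u by auto
      have "(SOME y. y \<in> C) \<in> cell m u" using cell_some[of "Suc m" u] cell_Suc[of m u] u by auto
      then show "(SOME y. y \<in> C) \<in> cell m x" using cell_eq[OF u(2)] by simp
    qed
    show ?thesis
    proof (cases "j \<le> m \<and> hit (m - j) m x")
      case True
      define i where "i = m - j"
      define C0 where "C0 = cell (Suc m) (c i x)"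
      have i: "i + j = m" "i \<le> m" using True i_def by auto
      have cm: "c i x \<in> cell m x" "G i x" using True unfolding hit_def i_def by auto
      have C0: "C0 \<in> S" unfolding C0_def S_def using cm by auto
      have e: "exp (e m j (SOME y. y \<in> C)) = (if C = C0 then exp (- v j) else 1) / Z j" if C: "C \<in> S" for C
      proof -
        let ?y = "SOME y. y \<in> C"
        have y: "hit i m ?y" using hit_cell[OF rep(2)[OF C] i(2)] True i_def by auto
        have "c i ?y = c i x" "G i ?y"
          using c_cell[of ?y i x] y rep(2)[OF C] cell_antimono[OF i(2), of x] unfolding hit_def by auto
        then have "hit i (Suc m) ?y \<longleftrightarrow> c i x \<in> C" unfolding hit_def using rep(1)[OF C] by auto
        also have "\<dots> \<longleftrightarrow> C = C0"
        proof
          assume "c i x \<in> C"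
          then have "c i x \<in> cell (Suc m) ?y" unfolding rep(1)[OF C] .
          from cell_eq[OF this] show "C = C0" unfolding C0_def rep(1)[OF C] ..
        next
          assume "C = C0"
          then show "c i x \<in> C" unfolding C0_def using cell_self by simp
        qed
        finally have "hit i (Suc m) ?y \<longleftrightarrow> C = C0" .
        then have "e m j ?y = (if C = C0 then - v j else 0) - ln (Z j)"
          using y True i unfolding e_def gain_def i_def[symmetric] by simp
        then show ?thesis using Z_pos[of j] by (simp add: exp_diff)
      qed
      have "(\<Sum>C\<in>S. exp (e m j (SOME y. y \<in> C))) = (\<Sum>C\<in>S. (if C = C0 then exp (- v j) else 1)) / Z j"
        using e by (simp add: sum_divide_distrib)
      also have "(\<Sum>C\<in>S. (if C = C0 then exp (- v j) else 1)) = exp (- v j) + (\<Sum>C\<in>S - {C0}. (if C = C0 then exp (- v j) else 1))"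
        using sum.remove[OF S(1) C0, of "\<lambda>C. if C = C0 then exp (- v j) else 1"] by simp
      also have "(\<Sum>C\<in>S - {C0}. (if C = C0 then exp (- v j) else 1)) = (\<Sum>C\<in>S - {C0}. 1 :: real)"
        by (intro sum.cong) auto
      also have "\<dots> = real (card S) - 1"
        using card.remove[OF S(1) C0] by simp
      also have "(exp (- v j) + (real (card S) - 1)) / Z j \<le> (exp (- v j) + (real D - 1)) / Z j"
        using S Z_pos[of j] by (intro divide_right_mono) auto
      also have "\<dots> = real D"
      proof -
        have "exp (- v j) + (real D - 1) = real D * Z j"
          unfolding Z_def using D1 by (simp add: field_simps)
        then show ?thesis using Z_pos[of j] by simp
      qed
      finally show ?thesis unfolding S_def .
    next
      case False
      have "e m j (SOME y. y \<in> C) = 0" if "C \<in> S" for C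
        using False hit_cell[OF rep(2)[OF that], of "m - j"] unfolding e_def gain_def by auto
      then have "(\<Sum>C\<in>S. exp (e m j (SOME y. y \<in> C))) = real (card S)" by simp
      then show ?thesis using S unfolding S_def by simp
    qed
  qed
  have bets: "AE x in M. eventually (\<lambda>n. exp (- t * real n) * (\<Prod>m<n. f m x) \<le> measure M (cell n x)) sequentially"
  proof (rule betting)
    show "0 \<le> f n x" for n x unfolding f_def by simp
    show "f n y = f n x" if "y \<in> cell (Suc n) x" for n x y
      unfolding f_def using e_cell[OF that] by simp
    show "0 < t" by (rule t)
    fix n x
    let ?S = "cell (Suc n) ` cell n x"
    have "(\<Sum>C\<in>?S. exp (\<Sum>j<k. w j * e n j (SOME y. y \<in> C)))
        \<le> (\<Sum>C\<in>?S. (\<Sum>j<k. w j * exp (e n j (SOME y. y \<in> C))) + (1 - (\<Sum>j<k. w j)))"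
      by (intro sum_mono exp_weighted_le) (use w in \<open>auto intro: less_imp_le\<close>)
    also have "\<dots> = (\<Sum>j<k. w j * (\<Sum>C\<in>?S. exp (e n j (SOME y. y \<in> C)))) + (1 - (\<Sum>j<k. w j)) * real (card ?S)"
      by (subst sum.distrib, subst sum.swap) (simp add: sum_distrib_left)
    also have "\<dots> \<le> (\<Sum>j<k. w j * real D) + (1 - (\<Sum>j<k. w j)) * real D"
      by (intro add_mono sum_mono mult_left_mono sum_e) (use w card_children in \<open>auto intro: less_imp_le\<close>)
    also have "\<dots> = real D" by (subst sum_distrib_right[symmetric]) (simp add: algebra_simps)
    finally show "(\<Sum>C\<in>?S. f n (SOME y. y \<in> C)) \<le> 1"
      unfolding f_def sum_divide_distrib[symmetric] using D1 by simp
  qed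
  have le: "exp (- (ln (real D) + t) * real n + T 0 * real (card {i \<in> {..<n}. G i x})
             - T k * (real (card {i \<in> {..<n}. G i x \<and> c i x \<in> cell (i + k) x}) + real k))
      \<le> exp (- t * real n) * (\<Prod>m<n. f m x)" for n x
  proof -
    \<comment> \<open>The potential argument, for one point and each starting generation \<open>i\<close>.\<close>
    define Pot where "Pot i j = (if hit i (i + j) x then T j else 0)" for i j
    have step: "Pot i j - Pot i (Suc j) \<le> w j * gain j i x" if "j < k" for i j
    proof -
      have wv: "w j * v j = T (Suc j)" unfolding v_def using w(1)[OF that] by simp
      have Tj: "T j \<le> - w j * ln (Z j)" using T[OF that] unfolding Z_def v_def by simp
      show ?thesis
      proof (cases "hit i (i + j) x")
        case True
        then show ?thesis unfolding Pot_def gain_def using Tj wv by (auto simp: algebra_simps)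
      next
        case False
        then have "\<not> hit i (i + Suc j) x" using hit_mono[of i "i + Suc j" x "i + j"] by auto
        then show ?thesis unfolding Pot_def gain_def using False by simp
      qed
    qed
    have Pot_last: "Pot i j \<le> T k * ((if hit i (i + k) x then 1 else 0) + (if j < k then 1 else 0))" if "j \<le> k" for i j
      unfolding Pot_def using T_le[of j] T_le[of k] that by (cases "j = k") auto
    have start: "(if G i x then T 0 else 0) \<le> Pot i 0" for i
      unfolding Pot_def hit_def using c_mem[of i x] by simp
    have "T 0 * real (card {i \<in> {..<n}. G i x}) - T k * (real (card {i \<in> {..<n}. G i x \<and> c i x \<in> cell (i + k) x}) + real k)
      \<le> T 0 * real (card {i \<in> {..<n}. G i x}) - T k * (real (card {i \<in> {..<n}. hit i (i + k) x}) + real (card {i \<in> {..<n}. n - i < k}))"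
    proof -
      have "{i \<in> {..<n}. n - i < k} \<subseteq> {n - k..<n}" by auto
      then have "card {i \<in> {..<n}. n - i < k} \<le> card {n - k..<n}" by (rule card_mono[rotated]) simp
      then have "card {i \<in> {..<n}. n - i < k} \<le> k" by simp
      then show ?thesis unfolding hit_def using T_le[of k] by (intro diff_left_mono mult_left_mono) auto
    qed
    also have "\<dots> = (\<Sum>i<n. (if G i x then T 0 else 0)) - T k * ((\<Sum>i<n. (if hit i (i + k) x then 1 else 0)) + (\<Sum>i<n. if n - i < k then 1 else 0))"
      by (simp add: sum_if_const)
    also have "\<dots> = (\<Sum>i<n. (if G i x then T 0 else 0) - T k * ((if hit i (i + k) x then 1 else 0) + (if n - i < k then 1 else 0)))"
      unfolding sum_subtractf sum_distrib_left[symmetric] sum.distrib ..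
    also have "\<dots> \<le> (\<Sum>i<n. Pot i 0 - Pot i (min k (n - i)))"
    proof (rule sum_mono)
      fix i assume "i \<in> {..<n}"
      have "(if min k (n - i) < k then 1 else 0 :: real) = (if n - i < k then 1 else 0)" by auto
      with Pot_last[of "min k (n - i)" i] start[of i]
      show "(if G i x then T 0 else 0) - T k * ((if hit i (i + k) x then 1 else 0) + (if n - i < k then 1 else 0))
          \<le> Pot i 0 - Pot i (min k (n - i))" by simp
    qed
    also have "\<dots> = (\<Sum>i<n. \<Sum>j<min k (n - i). Pot i j - Pot i (Suc j))"
      by (simp only: sum_lessThan_telescope')
    also have "\<dots> \<le> (\<Sum>i<n. \<Sum>j<min k (n - i). w j * gain j i x)"
      by (intro sum_mono step) auto
    also have "\<dots> = (\<Sum>m<n. \<Sum>j<k. if j \<le> m then w j * gain j (m - j) x else 0)"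
      by (rule sum_by_start[symmetric])
    also have "\<dots> = (\<Sum>m<n. \<Sum>j<k. w j * e m j x)"
      unfolding e_def by (intro sum.cong refl) auto
    finally have *: "T 0 * real (card {i \<in> {..<n}. G i x}) - T k * (real (card {i \<in> {..<n}. G i x \<and> c i x \<in> cell (i + k) x}) + real k)
      \<le> (\<Sum>m<n. \<Sum>j<k. w j * e m j x)" .
    have "(\<Prod>m<n. f m x) = exp (\<Sum>m<n. \<Sum>j<k. w j * e m j x) / real D ^ n"
      unfolding f_def by (simp add: prod_dividef exp_sum)
    also have "real D ^ n = exp (ln (real D) * real n)"
      using D1 by (simp add: exp_of_nat_mult mult.commute)
    finally have "exp (- t * real n) * (\<Prod>m<n. f m x) = exp (- (ln (real D) + t) * real n + (\<Sum>m<n. \<Sum>j<k. w j * e m j x))"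
      by (simp add: exp_diff[symmetric] exp_add[symmetric] algebra_simps)
    then show ?thesis using * by simp
  qed
  show ?thesis
    by (rule AE_mp[OF bets]) (intro AE_I2 impI, elim eventually_mono, rule order_trans[OF le])
qed

end

section \<open>The choice of the weights\<close>

text \<open>
  The next two lemmas bound from below the profit \<open>- ln (1 - p + p * exp (- v))\<close> earned by leaving the
  path to a hole, in the form \<open>p * v / (1 + \<kappa> * v)\<close> for which the recursion for the potentials
  can be solved explicitly. The value \<open>\<kappa> = 1\<close> serves for all \<open>p\<close>.
\<close>
lemma profit_ge:
  fixes p v :: real
  assumes p: "0 < p" "p < 1" and v: "0 \<le> v"
  shows "p * v / (1 + v) \<le> - ln (1 - p + p * exp (- v))"
proof -
  have "exp (- v) \<le> 1 / (1 + v)"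
    using exp_ge_add_one_self[of v] v by (simp add: exp_minus field_simps)
  then have "1 - p + p * exp (- v) \<le> 1 - p + p * (1 / (1 + v))"
    using p by (intro add_left_mono mult_left_mono) auto
  also have "\<dots> = 1 - p * v / (1 + v)" using v by (simp add: field_simps)
  finally have le: "1 - p + p * exp (- v) \<le> 1 - p * v / (1 + v)" .
  have pos: "0 < 1 - p + p * exp (- v)"
    using p by (intro add_pos_pos mult_pos_pos) auto
  have "ln (1 - p + p * exp (- v)) \<le> (1 - p + p * exp (- v)) - 1"
    using ln_le_minus_one[OF pos] .
  then show ?thesis using le by simp
qed

text \<open>
  In dimension one, where \<open>p = 1 / 2\<close>, the value \<open>\<kappa> = 1\<close> is too weak for the constant of the main
  theorem. As \<open>v\<close> grows, the two sides with \<open>\<kappa> = 3 / 4\<close> tend to \<open>2 / 3\<close> and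
  \<open>ln 2 \<approx> 0.693\<close>, so there is little room. Up to 2 the derivatives are compared; beyond, both
  sides are monotone and the values at 2 and 4 suffice.
\<close>
lemma profit_half_ge:
  fixes v :: real
  assumes v: "0 \<le> v"
  shows "(1 / 2) * v / (1 + 3 / 4 * v) \<le> - ln (1 - 1 / 2 + 1 / 2 * exp (- v))"
proof -
  define A where "A u = - ln ((1 + exp (- u)) / 2)" for u :: real
  have pos: "0 < (1 + exp (- u)) / 2" for u :: real by (simp add: add_pos_pos)
  have A_mono: "A u \<le> A u'" if "u \<le> u'" for u u'
    unfolding A_def using pos[of u] pos[of u'] that by (simp add: ln_le_cancel_iff)
  have B_mono: "2 * u / (4 + 3 * u) \<le> 2 * u' / (4 + 3 * u')" if "0 \<le> u" "u \<le> u'" for u u' :: real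
    using that by (simp add: field_simps)
  have average: "(1 + a) / 2 \<le> b" if "a \<le> c" "(1 + c) / 2 \<le> b" for a b c :: real
    using that by simp
  have A_ge: "c \<le> A u" if "(1 + exp (- u)) / 2 \<le> exp (- c)" for c u
  proof -
    have "ln ((1 + exp (- u)) / 2) \<le> ln (exp (- c))"
      using ln_le_cancel_iff[OF pos exp_gt_zero] that by blast
    then show ?thesis unfolding A_def by simp
  qed
  have A_2: "1 / 2 \<le> A 2"
  proof -
    have "(149 / 25 :: real) \<le> (1 + 2 / real 8) ^ 8" by (simp add: power_divide)
    also have "\<dots> \<le> exp 2" by (rule exp_ge_one_plus_x_over_n_power_n) auto
    finally have e: "exp (- 2 :: real) \<le> 25 / 149" by (simp add: exp_minus field_simps)
    have h: "87 / 149 \<le> exp (- (1 / 2) :: real)"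
    proof -
      have "(87 / 149 :: real) \<le> (1 + (- (1 / 2)) / real 4) ^ 4" by (simp add: power_divide)
      also have "\<dots> \<le> exp (- (1 / 2))" by (rule exp_ge_one_plus_x_over_n_power_n) auto
      finally show ?thesis .
    qed
    show ?thesis by (rule A_ge, rule average[OF e order_trans[OF _ h]]) simp
  qed
  have A_4: "2 / 3 \<le> A 4"
  proof -
    have "(48 :: real) \<le> (1 + 4 / real 64) ^ 64" by (simp add: power_divide)
    also have "\<dots> \<le> exp 4" by (rule exp_ge_one_plus_x_over_n_power_n) auto
    finally have e: "exp (- 4 :: real) \<le> 1 / 48" by (simp add: exp_minus field_simps)
    have h: "49 / 96 \<le> exp (- (2 / 3) :: real)"
    proof -
      have "(49 / 96 :: real) \<le> (1 + (- (2 / 3)) / real 64) ^ 64" by (simp add: power_divide)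
      also have "\<dots> \<le> exp (- (2 / 3))" by (rule exp_ge_one_plus_x_over_n_power_n) auto
      finally show ?thesis .
    qed
    show ?thesis by (rule A_ge, rule average[OF e order_trans[OF _ h]]) simp
  qed
  have small: "2 * u / (4 + 3 * u) \<le> A u" if u: "0 \<le> u" "u \<le> 2" for u
  proof -
    have "(A 0 - 2 * 0 / (4 + 3 * 0)) \<le> A u - 2 * u / (4 + 3 * u)"
    proof (rule DERIV_nonneg_imp_nondecreasing[OF u(1)])
      fix s :: real assume s: "0 \<le> s" "s \<le> u"
      have "((\<lambda>u. A u - 2 * u / (4 + 3 * u)) has_real_derivative
          exp (- s) / (1 + exp (- s)) - 8 / (4 + 3 * s)\<^sup>2) (at s)"
        unfolding A_def using s pos[of s]
        by (auto intro!: derivative_eq_intros simp: power2_eq_square) (simp add: field_simps)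
      moreover have "8 / (4 + 3 * s)\<^sup>2 \<le> exp (- s) / (1 + exp (- s))"
      proof -
        have "exp s \<le> 1 + 3 * s + 9 / 8 * s\<^sup>2"
        proof (cases "s \<le> 1")
          case True
          have "exp s \<le> 1 + s + s\<^sup>2" using s True by (intro exp_bound) auto
          also have "\<dots> \<le> 1 + 3 * s + 9 / 8 * s\<^sup>2" using s zero_le_power2[of s] by linarith
          finally show ?thesis .
        next
          case False
          have "exp s = exp 1 * exp (s - 1)" by (simp add: exp_add[symmetric])
          also have "\<dots> \<le> 3 * (1 + (s - 1) + (s - 1)\<^sup>2)"
            using s u False by (intro mult_mono exp_le exp_bound) auto
          also have "\<dots> \<le> 1 + 3 * s + 9 / 8 * s\<^sup>2"
          proof -
            have "(s - 1) * (s - 2) \<le> 0" using False s u by (intro mult_nonneg_nonpos) auto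
            then show ?thesis using s by (simp add: power2_eq_square algebra_simps)
          qed
          finally show ?thesis .
        qed
        then have "8 * (1 + exp s) \<le> (4 + 3 * s)\<^sup>2" by (simp add: power2_eq_square algebra_simps)
        then have "8 / (4 + 3 * s)\<^sup>2 \<le> 1 / (1 + exp s)"
          using s by (simp add: frac_le_eq divide_simps add_pos_pos) 
        also have "\<dots> = exp (- s) / (1 + exp (- s))" by (simp add: exp_minus field_simps)
        finally show ?thesis .
      qed
      ultimately show "\<exists>y. ((\<lambda>u. A u - 2 * u / (4 + 3 * u)) has_real_derivative y) (at s) \<and> 0 \<le> y"
        by (intro exI[of _ "exp (- s) / (1 + exp (- s)) - 8 / (4 + 3 * s)\<^sup>2"]) simp
    qed
    then show ?thesis by (simp add: A_def)
  qed
  have "2 * v / (4 + 3 * v) \<le> A v"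
  proof -
    consider "v \<le> 2" | "2 \<le> v" "v \<le> 4" | "4 \<le> v" by linarith
    then show ?thesis
    proof cases
      case 1
      then show ?thesis using small v by blast
    next
      case 2
      have "2 * v / (4 + 3 * v) \<le> 2 * 4 / (4 + 3 * 4)" using B_mono[of v 4] 2 v by simp
      also have "\<dots> \<le> A 2" using A_2 by simp
      also have "\<dots> \<le> A v" using A_mono 2 by simp
      finally show ?thesis .
    next
      case 3
      have "2 * v / (4 + 3 * v) \<le> 2 / 3" using v by (simp add: field_simps)
      also have "\<dots> \<le> A 4" by (rule A_4)
      also have "\<dots> \<le> A v" using A_mono 3 by simp
      finally show ?thesis .
    qed
  qed
  moreover have "(1 / 2) * v / (1 + 3 / 4 * v) = 2 * v / (4 + 3 * v)" using v by (simp add: field_simps)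
  moreover have "1 - 1 / 2 + 1 / 2 * exp (- v) = (1 + exp (- v)) / 2" by (simp add: field_simps)
  ultimately show ?thesis unfolding A_def by metis
qed

context
  fixes p \<kappa> :: real and k :: nat
  assumes p: "0 < p" "p < 1" and kap: "0 < \<kappa>"
begin

text \<open>
  With the profit bound above, the requirement of \<open>hole_bet\<close> becomes
  \<open>T j = p * T (j + 1) / (1 + \<kappa> * T (j + 1) / w j)\<close>, that is,
  \<open>1 / T j = 1 / (p * T (j + 1)) + \<kappa> / (p * w j)\<close>, which is linear in \<open>1 / T\<close>. Hence
  \<open>p ^ k / T 0\<close> is, up to the contribution of \<open>T k\<close>, equal to \<open>\<kappa>\<close> times the sum over \<open>m < k\<close> of
  \<open>p ^ m / w (k - 1 - m)\<close>. By Cauchy-Schwarz, among the weights with sum at most 1 the best choice is proportional to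
  \<open>sqrt p ^ m\<close>. The final potential \<open>T k\<close>, the penalty for falling into the hole, is chosen such that
  \<open>T 0\<close> comes out as \<open>p ^ k * (1 - sqrt p)\<^sup>2 / \<kappa>\<close> without an error term.
\<close>
definition weight :: "nat \<Rightarrow> real" where
  "weight j = (1 - sqrt p) * sqrt p ^ (k - Suc j)"

definition potential :: "nat \<Rightarrow> real" where
  "potential j = p ^ (k - j) * (1 - sqrt p)\<^sup>2 / (\<kappa> * (sqrt p ^ k + 1 - sqrt p ^ (k - j)))"

lemma sqrt_p: "0 < sqrt p" "sqrt p < 1" "sqrt p * sqrt p = p"
  using p by auto

lemma weight_pos: "0 < weight j"
  unfolding weight_def using sqrt_p by simp

lemma sum_weight_le_1: "(\<Sum>j<k. weight j) \<le> 1"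
proof -
  have "(\<Sum>j<k. weight j) = (1 - sqrt p) * (\<Sum>j<k. sqrt p ^ (k - Suc j))"
    unfolding weight_def by (rule sum_distrib_left[symmetric])
  also have "(\<Sum>j<k. sqrt p ^ (k - Suc j)) = (\<Sum>j<k. sqrt p ^ j)"
    by (rule sum.nat_diff_reindex)
  also have "(1 - sqrt p) * (\<Sum>j<k. sqrt p ^ j) = 1 - sqrt p ^ k"
    using sqrt_p by (simp add: one_diff_power_eq)
  also have "\<dots> \<le> 1" using sqrt_p by simp
  finally show ?thesis .
qed

lemma potential_denom_pos: "0 < sqrt p ^ k + 1 - sqrt p ^ m"
proof -
  have "sqrt p ^ m \<le> 1" using sqrt_p by (simp add: power_le_one)
  then show ?thesis using sqrt_p zero_less_power[of "sqrt p" k] by linarith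
qed

lemma potential_pos: "0 < potential j"
  unfolding potential_def using potential_denom_pos[of "k - j"] kap p sqrt_p by simp

lemma potential_start: "potential 0 = p ^ k * (1 - sqrt p)\<^sup>2 / \<kappa>"
  unfolding potential_def by simp

lemma potential_step:
  assumes j: "j < k"
  shows "potential j = p * potential (Suc j) / (1 + \<kappa> * (potential (Suc j) / weight j))"
proof -
  define r where "r = sqrt p"
  obtain m where m: "k - j = Suc m" "k - Suc j = m" using j by (metis Suc_diff_Suc)
  define E where "E = r ^ k + 1 - r ^ Suc m"
  define F where "F = r ^ k + 1 - r ^ m"
  have r: "0 < r" "r < 1" "p = r * r" using sqrt_p by (auto simp: r_def)
  have EF: "0 < E" "0 < F" unfolding E_def F_def r_def by (rule potential_denom_pos)+
  have E: "E = F + (1 - r) * r ^ m" unfolding E_def F_def by (simp add: algebra_simps)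
  have w: "weight j = (1 - r) * r ^ m" unfolding weight_def m r_def ..
  have pm: "p ^ m = r ^ m * r ^ m" using r by (simp add: power_mult_distrib)
  have T1: "potential (Suc j) = r ^ m * r ^ m * (1 - r)\<^sup>2 / (\<kappa> * F)"
    unfolding potential_def m F_def pm r_def ..
  have T0: "potential j = p * (r ^ m * r ^ m) * (1 - r)\<^sup>2 / (\<kappa> * E)"
    unfolding potential_def m E_def power_Suc[of p] pm r_def ..
  have "\<kappa> * (potential (Suc j) / weight j) = r ^ m * (1 - r) / F"
    unfolding T1 w using r kap EF by (simp add: field_simps power2_eq_square)
  then have "1 + \<kappa> * (potential (Suc j) / weight j) = E / F"
    using EF E by (simp add: field_simps)
  then show ?thesis unfolding T0 T1 using EF kap by simp
qed

lemma potential_le_last: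
  assumes "j \<le> k"
  shows "potential j \<le> potential k"
  using assms
proof (induction j rule: inc_induct)
  case (step j)
  let ?T = "potential (Suc j)"
  have "0 < \<kappa> * (?T / weight j)" using kap potential_pos weight_pos by simp
  then have "potential j \<le> p * ?T / 1"
    unfolding potential_step[OF step(2)] using p potential_pos[of "Suc j"]
    by (intro divide_left_mono) auto
  also have "\<dots> \<le> ?T" using p potential_pos[of "Suc j"] by simp
  finally show ?case using step.IH by simp
qed simp

end


section \<open>Descendants of small mass\<close>

text \<open>
  The product of the ratios \<open>a (i + k) / a i\<close> over \<open>i < n\<close> telescopes to a quotient of two
  products of \<open>k\<close> factors, so it is at least \<open>exp (- k * \<Lambda> * (n + k))\<close>; every index counted contributes
  a factor of at most \<open>\<epsilon>\<close>.
\<close>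
lemma count_drops:
  fixes a :: "nat \<Rightarrow> real"
  assumes a_le: "\<And>n. a n \<le> 1" and a_dec: "\<And>n. a (Suc n) \<le> a n"
    and lower: "\<And>n. n0 \<le> n \<Longrightarrow> exp (- \<Lambda> * real n) \<le> a n" and n: "n0 \<le> n"
    and eps: "0 < \<epsilon>" "\<epsilon> < 1" and L: "0 \<le> \<Lambda>"
  shows "real (card {i \<in> {..<n}. a (i + k) \<le> \<epsilon> * a i}) * ln (1 / \<epsilon>) \<le> real k * \<Lambda> * real (n + k)"
proof -
  define b where "b i = - ln (a i)" for i
  have dec: "a (i + j) \<le> a i" for i j
    using lift_Suc_antimono_le[of a i "i + j"] a_dec by auto
  have a_pos: "0 < a i" for i
    using dec[of i n0] lower[of "i + n0"] exp_gt_zero[of "- \<Lambda> * real (i + n0)"]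
    by (meson le_add2 less_le_trans)
  have b_mono: "b i \<le> b (i + j)" for i j
    unfolding b_def using dec[of i j] a_pos by simp
  have b_nonneg: "0 \<le> b i" for i
    unfolding b_def using a_pos[of i] a_le[of i] by simp
  have b_le: "b i \<le> \<Lambda> * real i" if "n0 \<le> i" for i
    unfolding b_def using lower[OF that] a_pos[of i] by (subst (asm) ln_ge_iff[symmetric]) auto
  have tele: "(\<Sum>i<n. b (i + k) - b i) = (\<Sum>l<k. b (n + l)) - (\<Sum>l<k. b l)"
  proof (induction k)
    case (Suc k)
    have "(\<Sum>i<n. b (i + Suc k) - b i) = (\<Sum>i<n. b (i + k) - b i) + (\<Sum>i<n. b (Suc (i + k)) - b (i + k))"
      by (simp add: sum.distrib[symmetric])
    also have "(\<Sum>i<n. b (Suc (i + k)) - b (i + k)) = b (n + k) - b k"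
      using sum_lessThan_telescope[of "\<lambda>i. b (i + k)" n] by simp
    finally show ?case using Suc by simp
  qed simp
  have "real (card {i \<in> {..<n}. a (i + k) \<le> \<epsilon> * a i}) * ln (1 / \<epsilon>)
      = (\<Sum>i<n. if a (i + k) \<le> \<epsilon> * a i then ln (1 / \<epsilon>) else 0)"
    by (simp add: sum_if_const)
  also have "\<dots> \<le> (\<Sum>i<n. b (i + k) - b i)"
  proof (rule sum_mono)
    fix i
    show "(if a (i + k) \<le> \<epsilon> * a i then ln (1 / \<epsilon>) else 0) \<le> b (i + k) - b i"
    proof (cases "a (i + k) \<le> \<epsilon> * a i")
      case True
      then have "ln (a (i + k)) \<le> ln (\<epsilon> * a i)" using a_pos eps by simp
      then show ?thesis using True a_pos[of i] eps unfolding b_def by (simp add: ln_mult ln_div)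
    qed (use b_mono in simp)
  qed
  also have "\<dots> \<le> (\<Sum>l<k. b (n + l))" unfolding tele by (simp add: sum_nonneg b_nonneg)
  also have "\<dots> \<le> (\<Sum>l<k. \<Lambda> * real (n + k))"
  proof (rule sum_mono)
    fix l assume "l \<in> {..<k}"
    have "b (n + l) \<le> \<Lambda> * real (n + l)" using n by (intro b_le) simp
    also have "\<dots> \<le> \<Lambda> * real (n + k)" using \<open>l \<in> {..<k}\<close> L by (intro mult_left_mono) auto
    finally show "b (n + l) \<le> \<Lambda> * real (n + k)" .
  qed
  finally show ?thesis by simp
qed

context partition_tree
begin

text \<open>
  The bets are applied to a chosen light descendant of each cell that has one. That such a cell is rarely
  entered follows from \<open>count_drops\<close>, because the bets themselves yield a crude lower bound
  \<open>exp (- \<Lambda> * n)\<close> for the mass, with a \<open>\<Lambda>\<close> independent of \<open>\<epsilon>\<close>: the number of visits to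
  holes is at most \<open>n\<close>. Letting \<open>\<epsilon>\<close> tend to 0 makes the penalty an arbitrarily small multiple of
  \<open>n\<close>.
\<close>
lemma light_hole_bet:
  fixes \<epsilon> \<kappa> t :: real and k :: nat
  defines "K \<equiv> potential (1 / real D) \<kappa> k k"
  assumes D: "1 < D"
    and kap: "0 < \<kappa>" "\<And>v. 0 \<le> v \<Longrightarrow> (1 / real D) * v / (1 + \<kappa> * v) \<le> - ln (1 - 1 / real D + 1 / real D * exp (- v))"
    and eps: "0 < \<epsilon>" "\<epsilon> < 1" and t: "0 < t" "t \<le> 1"
    and Lam: "ln (real D) + 1 + K * (1 + real k) \<le> \<Lambda>"
  shows "AE x in M. eventually (\<lambda>n.
      exp (- \<Lambda> * real n) \<le> measure M (cell n x) \<and>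
      exp (- (ln (real D) + t) * real n
        + potential (1 / real D) \<kappa> k 0 *
          real (card {i \<in> {..<n}. \<exists>z\<in>cell i x. measure M (cell (i + k) z) \<le> \<epsilon> * measure M (cell i x)})
        - K * (real k * \<Lambda> * real (n + k) / ln (1 / \<epsilon>) + real k)) \<le> measure M (cell n x)) sequentially"
proof -
  define p where "p = 1 / real D"
  have p: "0 < p" "p < 1" using D unfolding p_def by auto
  define T where "T = potential p \<kappa> k"
  define w where "w = weight p k"
  define hole where "hole i x z \<longleftrightarrow> z \<in> cell i x \<and> measure M (cell (i + k) z) \<le> \<epsilon> * measure M (cell i x)" for i x z
  define G where "G i x \<longleftrightarrow> (\<exists>z. hole i x z)" for i x
  define c where "c i x = (SOME z. hole i x z)" for i x
  have T_pos: "0 < T j" for j unfolding T_def by (rule potential_pos[OF p kap(1)])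
  have w_pos: "0 < w j" for j unfolding w_def by (rule weight_pos[OF p kap(1)])
  have K: "K = T k" "0 < K" using T_pos unfolding K_def T_def p_def by auto
  have hole_cell: "hole i y = hole i x" if "y \<in> cell i x" for i x y
    unfolding hole_def cell_eq[OF that] ..
  have c: "hole i x (c i x)" if "G i x" for i x
    using that unfolding G_def c_def by (rule someI_ex)
  have "AE x in M. eventually (\<lambda>n.
           exp (- (ln (real D) + t) * real n + T 0 * real (card {i \<in> {..<n}. G i x})
             - T k * (real (card {i \<in> {..<n}. G i x \<and> c i x \<in> cell (i + k) x}) + real k))
           \<le> measure M (cell n x)) sequentially"
  proof (rule hole_bet)
    show "0 < w j" for j by (rule w_pos)
    show "(\<Sum>j<k. w j) \<le> 1" unfolding w_def by (rule sum_weight_le_1[OF p kap(1)])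
    show "T j \<le> w j * - ln (1 - 1 / real D + exp (- T (Suc j) / w j) / real D)" if "j < k" for j
    proof -
      define v where "v = T (Suc j) / w j"
      have "0 \<le> v" unfolding v_def using T_pos[of "Suc j"] w_pos[of j] by simp
      have wv: "w j * v = T (Suc j)" unfolding v_def using w_pos[of j] by simp
      have "T j = w j * (p * v / (1 + \<kappa> * v))"
        using potential_step[OF p kap(1) that] unfolding T_def[symmetric] w_def[symmetric] v_def[symmetric]
        by (simp add: wv[symmetric])
      also have "\<dots> \<le> w j * - ln (1 - p + p * exp (- v))"
        using kap(2)[OF \<open>0 \<le> v\<close>] w_pos[of j] unfolding p_def by (intro mult_left_mono) auto
      finally show ?thesis unfolding v_def p_def by simp
    qed
    show "0 \<le> T j \<and> T j \<le> T k" if "j \<le> k" for j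
      using T_pos[of j] potential_le_last[OF p kap(1) that] unfolding T_def by simp
    show "G i y = G i x" "c i y = c i x" if "y \<in> cell i x" for i x y
      unfolding G_def c_def hole_cell[OF that] by (rule refl)+
    show "c i x \<in> cell i x" if "G i x" for i x using c[OF that] unfolding hole_def by simp
    show "0 < t" by (rule t)
  qed
  then show ?thesis
  proof (rule AE_mp, intro AE_I2 impI)
    fix x
    define cards where "cards n = real (card {i \<in> {..<n}. G i x})" for n
    define hits where "hits n = real (card {i \<in> {..<n}. G i x \<and> c i x \<in> cell (i + k) x})" for n
    assume ev: "eventually (\<lambda>n. exp (- (ln (real D) + t) * real n + T 0 * real (card {i \<in> {..<n}. G i x})
             - T k * (real (card {i \<in> {..<n}. G i x \<and> c i x \<in> cell (i + k) x}) + real k))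
           \<le> measure M (cell n x)) sequentially"
    have D1: "0 \<le> ln (real D)" using D by simp
    have Lam0: "0 \<le> \<Lambda>"
    proof -
      have "0 \<le> K * (1 + real k)" using K by simp
      then show ?thesis using Lam D1 by linarith
    qed
    have coarse: "eventually (\<lambda>n. exp (- \<Lambda> * real n) \<le> measure M (cell n x)) sequentially"
      using ev eventually_ge_at_top[of 1]
    proof eventually_elim
      case (elim n)
      have "card {i \<in> {..<n}. G i x \<and> c i x \<in> cell (i + k) x} \<le> card {..<n}" by (intro card_mono) auto
      then have "hits n \<le> real n" unfolding hits_def by simp
      moreover have "real k * 1 \<le> real k * real n" using elim(2) by (intro mult_left_mono) auto
      ultimately have "hits n + real k \<le> (1 + real k) * real n" by (simp add: algebra_simps)
      then have "K * (hits n + real k) \<le> K * ((1 + real k) * real n)" using K by (intro mult_left_mono) auto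
      moreover have "0 \<le> T 0 * cards n" using T_pos[of 0] unfolding cards_def by simp
      moreover have "(ln (real D) + t) * real n \<le> (ln (real D) + 1) * real n"
        using t by (intro mult_right_mono) auto
      moreover have "(ln (real D) + 1 + K * (1 + real k)) * real n \<le> \<Lambda> * real n"
        using Lam by (intro mult_right_mono) auto
      ultimately have "- \<Lambda> * real n \<le> - (ln (real D) + t) * real n + T 0 * cards n - T k * (hits n + real k)"
        unfolding K(1)[symmetric] by (simp add: algebra_simps)
      then show ?case using elim(1) unfolding cards_def hits_def by (meson exp_le_cancel_iff order_trans)
    qed
    then obtain n0 where n0: "\<And>n. n0 \<le> n \<Longrightarrow> exp (- \<Lambda> * real n) \<le> measure M (cell n x)"
      unfolding eventually_sequentially by auto
    have hits_le: "hits n \<le> real k * \<Lambda> * real (n + k) / ln (1 / \<epsilon>)" if "n0 \<le> n" for n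
    proof -
      have "real (card {i \<in> {..<n}. measure M (cell (i + k) x) \<le> \<epsilon> * measure M (cell i x)}) * ln (1 / \<epsilon>)
          \<le> real k * \<Lambda> * real (n + k)"
        by (rule count_drops[OF _ _ n0 that eps Lam0])
          (simp_all only: prob_le_1 finite_measure_mono[OF cell_Suc cell_sets])
      moreover have "{i \<in> {..<n}. G i x \<and> c i x \<in> cell (i + k) x}
          \<subseteq> {i \<in> {..<n}. measure M (cell (i + k) x) \<le> \<epsilon> * measure M (cell i x)}"
        using c cell_eq unfolding hole_def by fastforce
      then have "hits n \<le> real (card {i \<in> {..<n}. measure M (cell (i + k) x) \<le> \<epsilon> * measure M (cell i x)})"
        unfolding hits_def by (intro of_nat_mono card_mono) auto
      moreover have "0 < ln (1 / \<epsilon>)" using eps by simp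
      ultimately show ?thesis by (simp add: pos_le_divide_eq) (meson mult_right_mono order_trans less_imp_le)
    qed
    have "eventually (\<lambda>n. exp (- (ln (real D) + t) * real n + T 0 * cards n
             - K * (real k * \<Lambda> * real (n + k) / ln (1 / \<epsilon>) + real k)) \<le> measure M (cell n x)) sequentially"
      using ev eventually_ge_at_top[of n0]
    proof eventually_elim
      case (elim n)
      have "K * (hits n + real k) \<le> K * (real k * \<Lambda> * real (n + k) / ln (1 / \<epsilon>) + real k)"
        using hits_le[OF elim(2)] K by (intro mult_left_mono add_right_mono) auto
      then have "- (ln (real D) + t) * real n + T 0 * cards n - K * (real k * \<Lambda> * real (n + k) / ln (1 / \<epsilon>) + real k)
        \<le> - (ln (real D) + t) * real n + T 0 * cards n - T k * (hits n + real k)"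
        unfolding K(1)[symmetric] by simp
      then show ?case using elim(1) unfolding cards_def hits_def by (meson exp_le_cancel_iff order_trans)
    qed
    moreover have "cards n = real (card {i \<in> {..<n}. \<exists>z\<in>cell i x. measure M (cell (i + k) z) \<le> \<epsilon> * measure M (cell i x)})" for n
      unfolding cards_def G_def hole_def Bex_def ..
    ultimately show "eventually (\<lambda>n.
      exp (- \<Lambda> * real n) \<le> measure M (cell n x) \<and>
      exp (- (ln (real D) + t) * real n
        + potential (1 / real D) \<kappa> k 0 *
          real (card {i \<in> {..<n}. \<exists>z\<in>cell i x. measure M (cell (i + k) z) \<le> \<epsilon> * measure M (cell i x)})
        - K * (real k * \<Lambda> * real (n + k) / ln (1 / \<epsilon>) + real k)) \<le> measure M (cell n x)) sequentially"
      using coarse unfolding T_def p_def by (simp add: eventually_conj_iff)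
  qed
qed

end

section \<open>Shifted dyadic grids\<close>

text \<open>
  The half-open cubes of side \<open>\<theta> / 2 ^ n\<close> of a grid. The shift \<open>s\<close> is measured in units of
  \<open>\<theta>\<close> and is the same in all generations, so the grids of a fixed shift are nested.
\<close>
definition grid_cell :: "real \<Rightarrow> ('a \<Rightarrow> real) \<Rightarrow> nat \<Rightarrow> 'a::euclidean_space \<Rightarrow> 'a set" where
  "grid_cell \<theta> s n x =
     {y. \<forall>b\<in>Basis. \<lfloor>(y \<bullet> b / \<theta> - s b) * 2 ^ n\<rfloor> = \<lfloor>(x \<bullet> b / \<theta> - s b) * 2 ^ n\<rfloor>}"

lemma floor_half: "\<lfloor>u :: real\<rfloor> = \<lfloor>2 * u\<rfloor> div 2"
  using floor_divide_real_eq_div[of 2 "2 * u"] by simp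

lemma partition_tree_grid:
  fixes M :: "'a::euclidean_space measure"
  assumes "prob_space M" and M: "sets M = sets borel"
  shows "partition_tree M (grid_cell \<theta> s) (2 ^ DIM('a))"
proof -
  interpret prob_space M by fact
  define t where "t n b x = (x \<bullet> b / \<theta> - s b) * 2 ^ n" for n and b x :: 'a
  have t_Suc: "t (Suc n) b x = 2 * t n b x" for n b x unfolding t_def by simp
  have cell: "grid_cell \<theta> s n x = {y. \<forall>b\<in>Basis. \<lfloor>t n b y\<rfloor> = \<lfloor>t n b x\<rfloor>}" for n x
    unfolding grid_cell_def t_def ..
  show ?thesis
  proof unfold_locales
    show "grid_cell \<theta> s n x \<in> sets M" for n x
    proof -
      have "{y. \<lfloor>t n b y\<rfloor> = z} \<in> sets borel" for b z
        unfolding t_def by measurable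
      then have "(\<Inter>b\<in>Basis. {y. \<lfloor>t n b y\<rfloor> = \<lfloor>t n b x\<rfloor>}) \<in> sets borel"
        by (intro sets.finite_INT) auto
      also have "(\<Inter>b\<in>Basis. {y. \<lfloor>t n b y\<rfloor> = \<lfloor>t n b x\<rfloor>}) = grid_cell \<theta> s n x"
        unfolding cell by auto
      finally show ?thesis using M by simp
    qed
    show "x \<in> grid_cell \<theta> s n x" for n x unfolding cell by simp
    show "grid_cell \<theta> s n y = grid_cell \<theta> s n x" if "y \<in> grid_cell \<theta> s n x" for n x y
      using that unfolding cell by auto
    show "grid_cell \<theta> s (Suc n) x \<subseteq> grid_cell \<theta> s n x" for n x
    proof
      fix y assume y: "y \<in> grid_cell \<theta> s (Suc n) x"
      have "\<lfloor>t n b y\<rfloor> = \<lfloor>t n b x\<rfloor>" if "b \<in> Basis" for b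
        using y that floor_half[of "t n b y"] floor_half[of "t n b x"] unfolding cell t_Suc by simp
      then show "y \<in> grid_cell \<theta> s n x" unfolding cell by simp
    qed
    have "range (grid_cell \<theta> s 0) \<subseteq> (\<lambda>g. {y. \<forall>b\<in>Basis. \<lfloor>t 0 b y\<rfloor> = g b}) ` (PiE Basis (\<lambda>_. UNIV))"
    proof
      fix Q assume "Q \<in> range (grid_cell \<theta> s 0)"
      then obtain x where Q: "Q = grid_cell \<theta> s 0 x" by auto
      show "Q \<in> (\<lambda>g. {y. \<forall>b\<in>Basis. \<lfloor>t 0 b y\<rfloor> = g b}) ` (PiE Basis (\<lambda>_. UNIV))"
        by (rule image_eqI[of _ _ "restrict (\<lambda>b. \<lfloor>t 0 b x\<rfloor>) Basis"]) (auto simp: Q cell)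
    qed
    moreover have "countable (PiE Basis (\<lambda>_::'a. UNIV :: int set))" by (intro countable_PiE) auto
    ultimately show "countable (range (grid_cell \<theta> s 0))"
      by (rule countable_subset[OF _ countable_image])
    fix n and x :: 'a
    define I where "I = PiE (Basis :: 'a set) (\<lambda>_. {0, 1 :: int})"
    define h where "h e = {y. \<forall>b\<in>Basis. \<lfloor>t (Suc n) b y\<rfloor> = 2 * \<lfloor>t n b x\<rfloor> + e b}" for e
    have sub: "grid_cell \<theta> s (Suc n) ` grid_cell \<theta> s n x \<subseteq> h ` I"
    proof
      fix Q assume "Q \<in> grid_cell \<theta> s (Suc n) ` grid_cell \<theta> s n x"
      then obtain y where y: "y \<in> grid_cell \<theta> s n x" "Q = grid_cell \<theta> s (Suc n) y" by auto
      define e where "e = restrict (\<lambda>b. \<lfloor>t (Suc n) b y\<rfloor> mod 2) Basis"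
      have "\<lfloor>t (Suc n) b y\<rfloor> = 2 * \<lfloor>t n b x\<rfloor> + e b" if "b \<in> Basis" for b
      proof -
        have "\<lfloor>t n b x\<rfloor> = \<lfloor>t (Suc n) b y\<rfloor> div 2"
          using y(1) that floor_half[of "t n b y"] unfolding cell t_Suc by auto
        then show ?thesis unfolding e_def using that by simp
      qed
      then have "Q = h e" unfolding y(2) cell h_def by auto
      moreover have "e \<in> I" unfolding e_def I_def by auto
      ultimately show "Q \<in> h ` I" by blast
    qed
    have I: "finite I" "card I = 2 ^ DIM('a)"
      unfolding I_def by (auto simp: finite_PiE card_PiE numeral_2_eq_2)
    show "finite (grid_cell \<theta> s (Suc n) ` grid_cell \<theta> s n x)"
      by (rule finite_subset[OF sub finite_imageI[OF I(1)]])
    show "card (grid_cell \<theta> s (Suc n) ` grid_cell \<theta> s n x) \<le> 2 ^ DIM('a)"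
      using card_mono[OF finite_imageI[OF I(1)] sub] card_image_le[OF I(1), of h] I(2) by simp
  qed
qed

lemma grid_cell_dist:
  fixes x y :: "'a::euclidean_space"
  assumes "y \<in> grid_cell \<theta> s n x" and lam: "0 < \<theta>"
  shows "dist x y \<le> sqrt (real DIM('a)) * (\<theta> / 2 ^ n)"
proof -
  define c where "c = \<theta> / 2 ^ n"
  have c: "0 < c" using lam unfolding c_def by simp
  have "((x - y) \<bullet> b)\<^sup>2 \<le> c\<^sup>2" if b: "b \<in> Basis" for b
  proof -
    have "\<lfloor>(y \<bullet> b / \<theta> - s b) * 2 ^ n\<rfloor> = \<lfloor>(x \<bullet> b / \<theta> - s b) * 2 ^ n\<rfloor>"
      using assms b unfolding grid_cell_def by auto
    then have "\<bar>(x \<bullet> b / \<theta> - s b) * 2 ^ n - (y \<bullet> b / \<theta> - s b) * 2 ^ n\<bar> \<le> 1" by linarith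
    also have "(x \<bullet> b / \<theta> - s b) * 2 ^ n - (y \<bullet> b / \<theta> - s b) * 2 ^ n = ((x - y) \<bullet> b) / c"
      using lam by (simp add: c_def inner_diff_left field_simps)
    finally have "\<bar>(x - y) \<bullet> b\<bar> \<le> c" using c by (simp add: abs_divide divide_le_eq)
    then show ?thesis using c by (simp add: abs_le_square_iff[symmetric])
  qed
  then have "(\<Sum>b\<in>Basis. ((x - y) \<bullet> b)\<^sup>2) \<le> (\<Sum>b\<in>(Basis :: 'a set). c\<^sup>2)" by (rule sum_mono)
  then have "(norm (x - y))\<^sup>2 \<le> real DIM('a) * c\<^sup>2"
    unfolding power2_norm_eq_inner euclidean_inner[of "x - y" "x - y"] by (simp add: power2_eq_square)
  then have "norm (x - y) \<le> sqrt (real DIM('a) * c\<^sup>2)" by (rule real_le_rsqrt)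
  also have "\<dots> = sqrt (real DIM('a)) * c" using c by (simp add: real_sqrt_mult)
  finally show ?thesis unfolding c_def dist_norm .
qed

lemma card_ints_between:
  fixes X Y :: real
  assumes "X \<le> Y"
  shows "finite {h :: int. X < h \<and> h \<le> Y}" "real (card {h :: int. X < h \<and> h \<le> Y}) \<le> Y - X + 1"
proof -
  have *: "{h :: int. X < h \<and> h \<le> Y} = {\<lfloor>X\<rfloor><..\<lfloor>Y\<rfloor>}"
    by (auto simp: le_floor_iff floor_less_iff)
  show "finite {h :: int. X < h \<and> h \<le> Y}" unfolding * by simp
  have "\<lfloor>X\<rfloor> \<le> \<lfloor>Y\<rfloor>" using assms by (rule floor_mono)
  then have "real (card {\<lfloor>X\<rfloor><..\<lfloor>Y\<rfloor>}) = real_of_int (\<lfloor>Y\<rfloor> - \<lfloor>X\<rfloor>)" by simp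
  also have "\<dots> \<le> Y - X + 1" by linarith
  finally show "real (card {h :: int. X < h \<and> h \<le> Y}) \<le> Y - X + 1" unfolding * .
qed

text \<open>
  If \<open>X\<close> and \<open>Y\<close> are separated by an integer \<open>z\<close> after the shift by \<open>l\<close>, then \<open>N * z + l * 2 ^ i\<close> is an
  integer in the interval from \<open>N * X\<close> to \<open>N * Y\<close>. It determines \<open>l\<close>, because \<open>2 ^ i\<close> is invertible
  modulo the odd number \<open>N\<close>, so the number of bad shifts is at most that of the integers in this interval.
\<close>
lemma shifts_1d:
  fixes X Y :: real
  assumes N: "odd N" and XY: "X \<le> Y"
  shows "real N * (1 - (Y - X)) - 1
    \<le> real (card {l \<in> {..<N}. \<lfloor>X - real l / real N * 2 ^ i\<rfloor> = \<lfloor>Y - real l / real N * 2 ^ i\<rfloor>})"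
proof -
  have N0: "0 < N" using N by (cases N) auto
  define bad where "bad = {l \<in> {..<N}. \<lfloor>X - real l / real N * 2 ^ i\<rfloor> \<noteq> \<lfloor>Y - real l / real N * 2 ^ i\<rfloor>}"
  define good where "good = {l \<in> {..<N}. \<lfloor>X - real l / real N * 2 ^ i\<rfloor> = \<lfloor>Y - real l / real N * 2 ^ i\<rfloor>}"
  define H where "H = {h :: int. real N * X < h \<and> h \<le> real N * Y}"
  \<comment> \<open>For a bad shift the floor of the right end is a separating integer.\<close>
  define g where "g l = \<lfloor>Y - real l / real N * 2 ^ i\<rfloor> * int N + int l * 2 ^ i" for l
  have le: "real N * X \<le> real N * Y" using XY by (simp add: mult_left_mono)
  have "g l \<in> H" if "l \<in> bad" for l
  proof -
    define u where "u = real l / real N * 2 ^ i"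
    have u: "real N * u = real l * 2 ^ i" unfolding u_def using N0 by simp
    have "\<lfloor>X - u\<rfloor> < \<lfloor>Y - u\<rfloor>"
      using that floor_mono[of "X - u" "Y - u"] XY unfolding bad_def u_def by auto
    then have "X - u < \<lfloor>Y - u\<rfloor>" "\<lfloor>Y - u\<rfloor> \<le> Y - u" by linarith+
    then have "real N * (X - u) < real N * \<lfloor>Y - u\<rfloor>" "real N * \<lfloor>Y - u\<rfloor> \<le> real N * (Y - u)"
      using N0 by auto
    then show ?thesis unfolding H_def g_def u_def[symmetric]
      by (simp add: right_diff_distrib u) (simp add: mult.commute)
  qed
  moreover have "inj_on g bad"
  proof (rule inj_onI)
    fix l l' assume l: "l \<in> bad" "l' \<in> bad" and eq: "g l = g l'"
    have "(int l - int l') * 2 ^ i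
        = int N * (\<lfloor>Y - real l' / real N * 2 ^ i\<rfloor> - \<lfloor>Y - real l / real N * 2 ^ i\<rfloor>)"
      using eq unfolding g_def by (simp add: algebra_simps)
    then have "int N dvd (int l - int l') * 2 ^ i" by simp
    moreover have "coprime (int N) (2 ^ i)" using N by simp
    ultimately have dvd: "int N dvd int l - int l'" by (simp add: coprime_dvd_mult_left_iff)
    have small: "\<bar>int l - int l'\<bar> < int N" using l unfolding bad_def by auto
    show "l = l'"
    proof (rule ccontr)
      assume "l \<noteq> l'"
      then have "\<bar>int N\<bar> \<le> \<bar>int l - int l'\<bar>" by (intro dvd_imp_le_int[OF _ dvd]) simp
      then show False using small by simp
    qed
  qed
  ultimately have "card bad \<le> card H"
    unfolding H_def using card_ints_between(1)[OF le] by (intro card_inj_on_le[of g]) auto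
  then have "real (card bad) \<le> real N * (Y - X) + 1"
    using card_ints_between(2)[OF le] unfolding H_def by (simp add: algebra_simps)
  moreover have "card good + card bad = N"
  proof -
    have "card good + card bad = card (good \<union> bad)"
      by (rule card_Un_disjoint[symmetric]) (auto simp: good_def bad_def)
    also have "good \<union> bad = {..<N}" by (auto simp: good_def bad_def)
    finally show ?thesis by simp
  qed
  ultimately show ?thesis unfolding good_def[symmetric] by (simp add: algebra_simps)
qed

definition shifts :: "nat \<Rightarrow> ('a::euclidean_space \<Rightarrow> real) set" where
  "shifts N = PiE Basis (\<lambda>_. (\<lambda>l. real l / real N) ` {..<N})"

lemma finite_shifts: "finite (shifts N)"
  unfolding shifts_def by (intro finite_PiE) auto

lemma card_shifts: "0 < N \<Longrightarrow> card (shifts N :: ('a::euclidean_space \<Rightarrow> real) set) = N ^ DIM('a)"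
  unfolding shifts_def by (simp add: card_PiE card_image inj_on_def)

text \<open>
  In each coordinate, \<open>y\<close> and the projection of the ball span an interval of length at most \<open>R\<close>; the
  coordinates of a shift are independent of each other, so the one-dimensional counts multiply.
\<close>
lemma many_shifts:
  fixes x y :: "'a::euclidean_space"
  assumes N: "odd N" and lam: "0 < \<theta>"
    and R: "dist x y + \<tau> \<le> R" "2 * \<tau> \<le> R" "0 \<le> \<tau>"
    and nonneg: "0 \<le> real N * (1 - R * 2 ^ n / \<theta>) - 1"
  shows "(real N * (1 - R * 2 ^ n / \<theta>) - 1) ^ DIM('a)
    \<le> real (card {s \<in> shifts N. y \<in> grid_cell \<theta> s n x \<and> cball x \<tau> \<subseteq> grid_cell \<theta> s n x})"
proof -
  define lo where "lo b = min (x \<bullet> b - \<tau>) (y \<bullet> b)" for b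
  define hi where "hi b = max (x \<bullet> b + \<tau>) (y \<bullet> b)" for b
  define ok where "ok b = {\<sigma> \<in> (\<lambda>l. real l / real N) ` {..<N}.
     \<lfloor>(lo b / \<theta> - \<sigma>) * 2 ^ n\<rfloor> = \<lfloor>(hi b / \<theta> - \<sigma>) * 2 ^ n\<rfloor>}" for b
  have N0: "0 < N" using N by (cases N) auto
  have count: "real N * (1 - R * 2 ^ n / \<theta>) - 1 \<le> real (card (ok b))" if b: "b \<in> Basis" for b
  proof -
    have "\<bar>(x - y) \<bullet> b\<bar> \<le> dist x y" unfolding dist_norm by (rule Basis_le_norm[OF b])
    then have len: "hi b - lo b \<le> R" "lo b \<le> hi b"
      using R unfolding hi_def lo_def inner_diff_left by linarith+
    have "real N * (1 - R * 2 ^ n / \<theta>) - 1 \<le> real N * (1 - (hi b / \<theta> * 2 ^ n - lo b / \<theta> * 2 ^ n)) - 1"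
    proof -
      have "(hi b - lo b) * (2 ^ n / \<theta>) \<le> R * (2 ^ n / \<theta>)"
        using len lam by (intro mult_right_mono) auto
      then have "hi b / \<theta> * 2 ^ n - lo b / \<theta> * 2 ^ n \<le> R * 2 ^ n / \<theta>"
        by (simp add: algebra_simps diff_divide_distrib)
      then show ?thesis by (intro diff_right_mono mult_left_mono) auto
    qed
    also have "\<dots> \<le> real (card {l \<in> {..<N}. \<lfloor>lo b / \<theta> * 2 ^ n - real l / real N * 2 ^ n\<rfloor>
        = \<lfloor>hi b / \<theta> * 2 ^ n - real l / real N * 2 ^ n\<rfloor>})"
      using len lam by (intro shifts_1d N) (simp add: mult_right_mono divide_right_mono)
    also have "{l \<in> {..<N}. \<lfloor>lo b / \<theta> * 2 ^ n - real l / real N * 2 ^ n\<rfloor>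
        = \<lfloor>hi b / \<theta> * 2 ^ n - real l / real N * 2 ^ n\<rfloor>}
        = {l \<in> {..<N}. real l / real N \<in> ok b}"
      unfolding ok_def by (auto simp: left_diff_distrib)
    also have "card \<dots> = card (ok b)"
    proof (rule bij_betw_same_card[of "\<lambda>l. real l / real N"])
      show "bij_betw (\<lambda>l. real l / real N) {l \<in> {..<N}. real l / real N \<in> ok b} (ok b)"
        using N0 unfolding bij_betw_def ok_def by (auto simp: inj_on_def)
    qed
    finally show ?thesis by simp
  qed
  have "(real N * (1 - R * 2 ^ n / \<theta>) - 1) ^ DIM('a) = (\<Prod>b\<in>(Basis :: 'a set). real N * (1 - R * 2 ^ n / \<theta>) - 1)"
    by simp
  also have "\<dots> \<le> (\<Prod>b\<in>(Basis :: 'a set). real (card (ok b)))"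
    by (intro prod_mono conjI nonneg count)
  also have "\<dots> = real (card (PiE Basis ok))" by (simp add: card_PiE)
  also have "\<dots> \<le> real (card {s \<in> shifts N. y \<in> grid_cell \<theta> s n x \<and> cball x \<tau> \<subseteq> grid_cell \<theta> s n x})"
  proof -
    have "PiE Basis ok \<subseteq> {s \<in> shifts N. y \<in> grid_cell \<theta> s n x \<and> cball x \<tau> \<subseteq> grid_cell \<theta> s n x}"
    proof
      fix s assume s: "s \<in> PiE Basis ok"
      have "s \<in> shifts N" using s unfolding shifts_def ok_def by (auto simp: PiE_iff)
      have mem: "z \<in> grid_cell \<theta> s n x" if z: "\<And>b. b \<in> Basis \<Longrightarrow> lo b \<le> z \<bullet> b \<and> z \<bullet> b \<le> hi b" for z
        unfolding grid_cell_def
      proof (intro CollectI ballI)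
        fix b :: 'a assume b: "b \<in> Basis"
        define F where "F u = \<lfloor>(u / \<theta> - s b) * 2 ^ n\<rfloor>" for u
        have F_mono: "F u \<le> F u'" if "u \<le> u'" for u u'
          unfolding F_def using that lam by (intro floor_mono mult_right_mono diff_right_mono divide_right_mono) auto
        have "F (lo b) = F (hi b)" using s b unfolding ok_def F_def by (auto simp: PiE_iff)
        moreover have "F (lo b) \<le> F (z \<bullet> b)" "F (z \<bullet> b) \<le> F (hi b)" using z[OF b] by (auto intro: F_mono)
        moreover have "F (lo b) \<le> F (x \<bullet> b)" "F (x \<bullet> b) \<le> F (hi b)"
          using R by (auto intro!: F_mono simp: lo_def hi_def)
        ultimately have "F (z \<bullet> b) = F (x \<bullet> b)" by linarith
        then show "\<lfloor>(z \<bullet> b / \<theta> - s b) * 2 ^ n\<rfloor> = \<lfloor>(x \<bullet> b / \<theta> - s b) * 2 ^ n\<rfloor>" unfolding F_def .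
      qed
      have "y \<in> grid_cell \<theta> s n x" by (rule mem) (auto simp: lo_def hi_def)
      moreover have "cball x \<tau> \<subseteq> grid_cell \<theta> s n x"
      proof
        fix z assume z: "z \<in> cball x \<tau>"
        show "z \<in> grid_cell \<theta> s n x"
        proof (rule mem)
          fix b :: 'a assume "b \<in> Basis"
          then have "\<bar>(x - z) \<bullet> b\<bar> \<le> \<tau>" using Basis_le_norm[of b "x - z"] z by (simp add: dist_norm)
          then show "lo b \<le> z \<bullet> b \<and> z \<bullet> b \<le> hi b" unfolding lo_def hi_def inner_diff_left by linarith
        qed
      qed
      ultimately show "s \<in> {s \<in> shifts N. y \<in> grid_cell \<theta> s n x \<and> cball x \<tau> \<subseteq> grid_cell \<theta> s n x}"
        using \<open>s \<in> shifts N\<close> by simp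
    qed
    then have "card (PiE Basis ok)
        \<le> card {s \<in> shifts N. y \<in> grid_cell \<theta> s n x \<and> cball x \<tau> \<subseteq> grid_cell \<theta> s n x}"
      by (rule card_mono[rotated]) (simp add: finite_shifts)
    then show ?thesis by simp
  qed
  finally show ?thesis .
qed

section \<open>The upper local dimension\<close>

text \<open>
  The balls \<open>cball x r\<close> are the sections of a closed subset of the product space.
\<close>
lemma measurable_measure_cball:
  fixes M :: "'a::euclidean_space measure"
  assumes "prob_space M" and M: "sets M = sets borel"
  shows "(\<lambda>x. measure M (cball x r)) \<in> borel_measurable M"
proof -
  interpret prob_space M by fact
  have "closed {q :: 'a \<times> 'a. dist (fst q) (snd q) \<le> r}"
    by (intro closed_Collect_le continuous_intros)
  then have "{q :: 'a \<times> 'a. dist (fst q) (snd q) \<le> r} \<in> sets (borel :: ('a \<times> 'a) measure)"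
    by (rule borel_closed)
  also have "sets (borel :: ('a \<times> 'a) measure) = sets (M \<Otimes>\<^sub>M M)"
    unfolding borel_prod[symmetric] by (intro sets_pair_measure_cong) (simp_all add: M)
  finally have "(\<lambda>x. emeasure M (Pair x -` {q. dist (fst q) (snd q) \<le> r})) \<in> borel_measurable M"
    by (rule measurable_emeasure_Pair)
  moreover have "Pair x -` {q. dist (fst q) (snd q) \<le> r} = cball x r" for x :: 'a by auto
  ultimately have "(\<lambda>x. emeasure M (cball x r)) \<in> borel_measurable M" by simp
  then show ?thesis unfolding measure_def by measurable
qed

text \<open>
  The essential supremum is \<open>\<infinity>\<close> on functions that are not measurable, so measurability is needed for
  an upper bound. The masses of closed balls are continuous from the right in the radius, hence the
  limit superior may be taken along rational radii. Where a ball has mass 0 the quotient is 0, by the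
  convention \<open>ln 0 = 0\<close>, and no continuity is needed since all quotients are nonnegative for radii below 1.
\<close>
lemma measurable_upper_local_dim:
  fixes M :: "'a::euclidean_space measure"
  assumes "prob_space M" and M: "sets M = sets borel"
  shows "upper_local_dim M \<in> borel_measurable M"
proof -
  interpret prob_space M by fact
  have cball_sets: "cball x r \<in> sets M" for x r using M by simp
  define g where "g x r = ereal (ln (measure M (cball x r)) / ln r)" for x r
  define I where "I n = \<rat> \<inter> {0<..<1 / real (n + 2)}" for n :: nat
  have cont: "(\<lambda>n. g x (q n)) \<longlonglongrightarrow> g x r"
    if r: "0 < r" "r < 1" and pos: "0 < measure M (cball x r)"
      and q: "\<And>n. r < q n" "\<And>n. q n < r + 1 / real (Suc n)" for x r and q :: "nat \<Rightarrow> real"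
  proof -
    define m where "m r = measure M (cball x r)" for r
    have m_mono: "m u \<le> m u'" if "u \<le> u'" for u u'
      unfolding m_def using that by (intro finite_measure_mono cball_sets) auto
    have inv: "(\<lambda>n. r + 1 / real (Suc n)) \<longlonglongrightarrow> r + 0"
      by (intro tendsto_intros LIMSEQ_Suc lim_1_over_n)
    have "(\<lambda>n. m (r + 1 / real (Suc n))) \<longlonglongrightarrow> measure M (\<Inter>n. cball x (r + 1 / real (Suc n)))"
      unfolding m_def
    proof (rule finite_Lim_measure_decseq)
      show "range (\<lambda>n. cball x (r + 1 / real (Suc n))) \<subseteq> sets M" using cball_sets by auto
      show "decseq (\<lambda>n. cball x (r + 1 / real (Suc n)))"
        by (intro decseq_SucI subset_cball) (auto simp: frac_le)
    qed
    also have "(\<Inter>n. cball x (r + 1 / real (Suc n))) = cball x r"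
    proof
      show "(\<Inter>n. cball x (r + 1 / real (Suc n))) \<subseteq> cball x r"
      proof
        fix z assume "z \<in> (\<Inter>n. cball x (r + 1 / real (Suc n)))"
        then have "dist x z \<le> r + 1 / real (Suc n)" for n by auto
        then show "z \<in> cball x r" using LIMSEQ_le_const[OF inv] by auto
      qed
      show "cball x r \<subseteq> (\<Inter>n. cball x (r + 1 / real (Suc n)))"
        by (intro INF_greatest subset_cball) simp
    qed
    finally have up: "(\<lambda>n. m (r + 1 / real (Suc n))) \<longlonglongrightarrow> m r" unfolding m_def .
    have q_le: "r \<le> q n" "q n \<le> r + 1 / real (Suc n)" for n
      using q[of n] by (simp_all add: less_imp_le)
    have mq: "(\<lambda>n. m (q n)) \<longlonglongrightarrow> m r"
      by (rule tendsto_sandwich[OF _ _ tendsto_const up]; intro always_eventually allI m_mono q_le)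
    have "q \<longlonglongrightarrow> r"
    proof (rule tendsto_sandwich[OF _ _ tendsto_const])
      show "(\<lambda>n. r + 1 / real (Suc n)) \<longlonglongrightarrow> r" using inv by simp
    qed (intro always_eventually allI q_le)+
    then have "(\<lambda>n. ln (m (q n)) / ln (q n)) \<longlonglongrightarrow> ln (m r) / ln r"
      using mq r pos by (intro tendsto_divide tendsto_ln) (auto simp: m_def)
    then show ?thesis unfolding g_def m_def by simp
  qed
  have g_nonneg: "0 \<le> g x r" if "0 < r" "r < 1" for x r
  proof -
    have "ln (measure M (cball x r)) \<le> 0"
      using ln_le_zero_iff[of "measure M (cball x r)"] zero_less_measure_iff[of M "cball x r"]
      by (cases "measure M (cball x r) = 0") auto
    then show ?thesis unfolding g_def using that by (simp add: divide_nonpos_neg)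
  qed
  have dense: "g x r \<le> (SUP q\<in>I n. g x q)" if r: "r \<in> {0<..<1 / real (n + 2)}" for x r n
  proof -
    define s where "s = 1 / real (n + 2)"
    have s: "0 < s" "s < 1" "r < s" "0 < r" using r unfolding s_def by auto
    have "\<exists>q\<in>\<rat>. r < q \<and> q < min s (r + 1 / real (Suc l))" for l
      using s by (intro Rats_dense_in_real) simp
    then obtain q where q: "\<And>l. q l \<in> \<rat>" "\<And>l. r < q l" "\<And>l. q l < s" "\<And>l. q l < r + 1 / real (Suc l)"
      by (metis min_less_iff_conj)
    have qI: "q l \<in> I n" for l using q s unfolding I_def s_def[symmetric] by (auto intro: less_trans)
    show ?thesis
    proof (cases "measure M (cball x r) = 0")
      case True
      then have "g x r = 0" unfolding g_def by simp
      also have "\<dots> \<le> g x (q 0)" using q(2,3)[of 0] s by (intro g_nonneg) auto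
      also have "\<dots> \<le> (SUP q\<in>I n. g x q)" using qI by (rule SUP_upper)
      finally show ?thesis .
    next
      case False
      then have "(\<lambda>l. g x (q l)) \<longlonglongrightarrow> g x r"
        using s q by (intro cont) (auto simp: zero_less_measure_iff)
      then show ?thesis by (rule LIMSEQ_le_const2) (use qI in \<open>auto intro: SUP_upper\<close>)
    qed
  qed
  have "upper_local_dim M x = (INF n. SUP q\<in>I n. g x q)" for x
  proof (rule antisym)
    show "upper_local_dim M x \<le> (INF n. SUP q\<in>I n. g x q)"
    proof (rule INF_greatest)
      fix n
      show "upper_local_dim M x \<le> (SUP q\<in>I n. g x q)"
        unfolding upper_local_dim_def g_def[symmetric]
      proof (rule Limsup_bounded)
        show "eventually (\<lambda>r. g x r \<le> (SUP q\<in>I n. g x q)) (at_right 0)"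
          by (rule eventually_at_rightI[of 0 "1 / real (n + 2)"]) (use dense in auto)
      qed
    qed
    show "(INF n. SUP q\<in>I n. g x q) \<le> upper_local_dim M x"
      unfolding upper_local_dim_def g_def[symmetric] Limsup_def
    proof (rule INF_greatest)
      fix P assume "P \<in> {P. eventually P (at_right (0 :: real))}"
      then obtain e where e: "0 < e" "\<And>r. 0 < r \<Longrightarrow> r < e \<Longrightarrow> P r"
        unfolding mem_Collect_eq eventually_at_right_field by auto
      obtain n where n: "1 / real (Suc n) < e" using e(1) nat_approx_posE by blast
      have "1 / real (n + 2) \<le> 1 / real (Suc n)" by (intro frac_le) auto
      then have "I n \<subseteq> {r. P r}" using e n unfolding I_def by auto
      then have "(SUP q\<in>I n. g x q) \<le> (SUP r\<in>{r. P r}. g x r)" by (intro SUP_subset_mono) auto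
      then show "(INF n. SUP q\<in>I n. g x q) \<le> (SUP r\<in>{r. P r}. g x r)"
        by (rule INF_lower2[OF UNIV_I])
    qed
  qed
  moreover have "(\<lambda>x. INF n. SUP q\<in>I n. g x q) \<in> borel_measurable M"
  proof -
    have "countable (I n)" for n unfolding I_def by (intro countable_Int1 countable_rat)
    moreover have "(\<lambda>x. g x q) \<in> borel_measurable M" for q
      unfolding g_def using measurable_measure_cball[OF assms, of q] by measurable
    ultimately show ?thesis by (intro borel_measurable_INF borel_measurable_SUP) auto
  qed
  ultimately show ?thesis by (simp cong: measurable_cong)
qed

text \<open>
  Between consecutive radii \<open>R / 2 ^ n\<close> the mass is monotone and \<open>ln r\<close> changes by at most
  \<open>ln 2\<close>, so these radii determine the upper local dimension.
\<close>
lemma upper_local_dim_le: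
  fixes M :: "'a::euclidean_space measure"
  assumes "prob_space M" and M: "sets M = sets borel"
    and R: "0 < R" and xi: "\<xi> / ln 2 < c"
    and ev: "eventually (\<lambda>n. exp (- \<xi> * real n) \<le> measure M (cball x (R / 2 ^ n))) sequentially"
  shows "upper_local_dim M x \<le> ereal c"
proof -
  interpret prob_space M by fact
  have cball_sets: "cball x r \<in> sets M" for r using M by simp
  define A where "A = c * ln 2 - \<xi>"
  have A: "0 < A" using xi unfolding A_def by (simp add: field_simps)
  obtain n0 where n0: "\<And>n. n0 \<le> n \<Longrightarrow> exp (- \<xi> * real n) \<le> measure M (cball x (R / 2 ^ n))"
    using ev unfolding eventually_sequentially by auto
  have "exp (- \<xi> * real (Suc n0)) \<le> 1"
    using n0[of "Suc n0"] prob_le_1[of "cball x (R / 2 ^ Suc n0)"] by linarith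
  then have xi0: "0 \<le> \<xi>" by (simp add: zero_le_mult_iff)
  then have "0 \<le> \<xi> / ln 2" by simp
  then have c: "0 < c" using xi by linarith
  obtain n1 :: nat where n1: "\<bar>c * (ln 2 + ln R)\<bar> / A < real n1" using reals_Archimedean2 by blast
  obtain n2 :: nat where n2: "(ln 2 + ln R) / ln 2 < real n2" using reals_Archimedean2 by blast
  define m where "m = max n0 (max n1 n2)"
  have "ln (measure M (cball x r)) / ln r \<le> c" if r: "0 < r" "r < R / 2 ^ m" "r < 1" for r
  proof -
    have "\<exists>n. R / 2 ^ n \<le> r"
    proof -
      obtain n where "(1 / 2) ^ n < r / R" using real_arch_pow_inv[of "r / R" "1 / 2"] r R by auto
      then show ?thesis using R by (intro exI[of _ n]) (simp add: field_simps power_divide)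
    qed
    then obtain n where n: "R / 2 ^ n \<le> r" "\<And>l. l < n \<Longrightarrow> r < R / 2 ^ l"
      using exists_least_iff[of "\<lambda>n. R / 2 ^ n \<le> r"] by (auto simp: not_le)
    have "m < n"
    proof (rule ccontr)
      assume "\<not> m < n"
      then have "R / 2 ^ m \<le> R / 2 ^ n" using R by (intro divide_left_mono power_increasing) auto
      then show False using n(1) r by simp
    qed
    have lnr: "- ln r \<ge> (real n - 1) * ln 2 - ln R"
    proof -
      have "r < R / 2 ^ (n - 1)" using n(2)[of "n - 1"] \<open>m < n\<close> by simp
      then have "ln r < ln (R / 2 ^ (n - 1))" using r R by simp
      also have "\<dots> = ln R - real (n - 1) * ln 2" using R by (simp add: ln_div ln_realpow)
      also have "real (n - 1) = real n - 1" using \<open>m < n\<close> by simp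
      finally show ?thesis by simp
    qed
    have "exp (- \<xi> * real n) \<le> measure M (cball x (R / 2 ^ n))"
      using \<open>m < n\<close> by (intro n0) (simp add: m_def)
    also have "\<dots> \<le> measure M (cball x r)"
      using n(1) by (intro finite_measure_mono cball_sets subset_cball)
    finally have low: "exp (- \<xi> * real n) \<le> measure M (cball x r)" .
    then have "- \<xi> * real n \<le> ln (measure M (cball x r))"
      using less_le_trans[OF exp_gt_zero low] by (subst ln_ge_iff) simp_all
    then have "- ln (measure M (cball x r)) \<le> \<xi> * real n" by simp
    also have "\<dots> \<le> c * ((real n - 1) * ln 2 - ln R)"
    proof -
      have "\<bar>c * (ln 2 + ln R)\<bar> / A < real n" using n1 \<open>m < n\<close> unfolding m_def by simp
      then have "c * (ln 2 + ln R) < A * real n" using A by (simp add: divide_less_eq mult.commute)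
      then show ?thesis unfolding A_def by (simp add: algebra_simps)
    qed
    also have "\<dots> \<le> c * - ln r" using lnr c by (intro mult_left_mono) auto
    finally have "c * ln r \<le> ln (measure M (cball x r))" by simp
    moreover have "ln r < 0" using r by simp
    ultimately show ?thesis by (simp add: neg_divide_le_eq)
  qed
  then have "eventually (\<lambda>r. ereal (ln (measure M (cball x r)) / ln r) \<le> ereal c) (at_right 0)"
    using R by (intro eventually_at_rightI[of 0 "min 1 (R / 2 ^ m)"]) auto
  then show ?thesis unfolding upper_local_dim_def by (rule Limsup_bounded)
qed

section \<open>Mean porous measures\<close>

text \<open>
  Neither the supremum nor the infimum in the definition of porosity need be attained, which costs a slightly
  smaller radius and the factor 2.
\<close>
lemma por_hole:
  fixes M :: "'a::euclidean_space measure"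
  assumes "prob_space M" and M: "sets M = sets borel"
    and por: "ereal \<alpha> \<le> por M x r \<epsilon>" and eps: "0 < \<epsilon>" and a: "0 \<le> \<alpha>'" "\<alpha>' < \<alpha>" and r: "0 < r"
  obtains y where "dist x y + \<alpha>' * r \<le> r"
    and "measure M (cball y (\<alpha>' * r)) \<le> 2 * \<epsilon> * measure M (cball x r)"
proof -
  interpret prob_space M by fact
  have cball_sets: "cball z s \<in> sets M" for z s using M by simp
  have "ereal \<alpha>' < ereal \<alpha>" using a by simp
  also note por
  finally obtain a where a': "\<alpha>' < a"
    and inf: "(INF y\<in>{y. cball y (a * r) \<subseteq> cball x r}.
           ereal (measure M (cball y (a * r)) / measure M (cball x r))) \<le> ereal \<epsilon>"
    unfolding por_def less_SUP_iff by auto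
  have "ereal \<epsilon> < ereal (2 * \<epsilon>)" using eps by simp
  with inf have "(INF y\<in>{y. cball y (a * r) \<subseteq> cball x r}.
           ereal (measure M (cball y (a * r)) / measure M (cball x r))) < ereal (2 * \<epsilon>)"
    by (rule le_less_trans)
  then obtain y where y: "cball y (a * r) \<subseteq> cball x r"
      "measure M (cball y (a * r)) / measure M (cball x r) < 2 * \<epsilon>"
    unfolding INF_less_iff by auto
  have ar: "\<alpha>' * r \<le> a * r" "0 \<le> a * r" using a' a r by auto
  show ?thesis
  proof (rule that)
    show "dist x y + \<alpha>' * r \<le> r"
      using y(1) ar unfolding cball_subset_cball_iff by (auto simp: dist_commute)
    have "measure M (cball y (\<alpha>' * r)) \<le> measure M (cball y (a * r))"
      using ar by (intro finite_measure_mono cball_sets subset_cball)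
    also have "\<dots> \<le> 2 * \<epsilon> * measure M (cball x r)"
    proof (cases "measure M (cball x r) = 0")
      case True
      have "measure M (cball y (a * r)) \<le> measure M (cball x r)"
        using y(1) by (intro finite_measure_mono cball_sets)
      then show ?thesis using True by simp
    next
      case False
      then have "0 < measure M (cball x r)" by (simp add: zero_less_measure_iff)
      then show ?thesis using y(2) by (simp add: divide_less_eq)
    qed
    finally show "measure M (cball y (\<alpha>' * r)) \<le> 2 * \<epsilon> * measure M (cball x r)" .
  qed
qed

text \<open>
  A hole near a porous point \<open>x\<close> is light compared with a ball about \<open>x\<close>, whereas the bets need a hole
  that is light compared with the surrounding cell, which need not contain that ball. For
  the shifts counted in \<open>many_shifts\<close> it contains a much smaller concentric ball, and by
  \<open>count_drops\<close> the masses of the two balls are comparable at all but a small proportion of the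
  scales. At a porous scale that is comparable in this sense, the cell of \<open>x\<close> therefore has a light
  descendant for each of these shifts. Summing over the shifts bounds the average of the profits in
  \<open>light_hole_bet\<close> from below.
\<close>
lemma mass_lower_bound:
  fixes M :: "'a::euclidean_space measure" and \<alpha> \<alpha>' \<eta> \<theta> \<kappa> \<gamma> :: real and k N :: nat
  defines "E \<equiv> potential (1 / 2 ^ DIM('a)) \<kappa> k 0 * (1 - 1 / \<theta> - 1 / real N) ^ DIM('a)"
  assumes prob: "prob_space M" and M: "sets M = sets borel"
    and porous: "mean_porous \<alpha> \<eta> M"
    and a: "0 < \<alpha>'" "\<alpha>' < \<alpha>" "\<alpha> \<le> 1 / 2" and th: "0 < \<theta>"
    and N: "odd N" "0 \<le> real N * (1 - 1 / \<theta>) - 1"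
    and size: "sqrt (real DIM('a)) * (\<theta> / 2 ^ k) \<le> \<alpha>'"
    and kap: "0 < \<kappa>" "\<And>v. 0 \<le> v \<Longrightarrow>
      (1 / 2 ^ DIM('a)) * v / (1 + \<kappa> * v) \<le> - ln (1 - 1 / 2 ^ DIM('a) + 1 / 2 ^ DIM('a) * exp (- v))"
    and gam: "0 < \<gamma>"
  shows "AE x in M. eventually (\<lambda>n. exp (- (real DIM('a) * ln 2 - E * \<eta> + \<gamma>) * real n)
      \<le> measure M (cball x (sqrt (real DIM('a)) * (\<theta> / 2 ^ n)))) sequentially"
proof -
  interpret prob_space M by fact
  have cball_sets: "cball z s \<in> sets M" for z s using M by simp
  define d where "d = DIM('a)"
  define S where "S = (shifts N :: ('a \<Rightarrow> real) set)"
  define \<phi> where "\<phi> = 1 - 1 / \<theta> - 1 / real N"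
  define T where "T = potential (1 / 2 ^ d) \<kappa> k 0"
  define K where "K = potential (1 / 2 ^ d) \<kappa> k k"
  define R where "R = sqrt (real d) * \<theta>"
  have d: "0 < d" unfolding d_def by simp
  have fin_S: "finite S" unfolding S_def by (rule finite_shifts)
  have N0: "0 < N" using N(1) by (cases N) auto
  have phi: "real N * (1 - 1 / \<theta>) - 1 = real N * \<phi>" "0 \<le> \<phi>"
  proof -
    show "real N * (1 - 1 / \<theta>) - 1 = real N * \<phi>" using N0 unfolding \<phi>_def by (simp add: field_simps)
    then show "0 \<le> \<phi>" using N(2) N0 by (simp add: zero_le_mult_iff)
  qed
  have "0 < 1 / (2 :: real) ^ d" "1 / (2 :: real) ^ d < 1"
    using d by (auto simp: one_less_power)
  then have TK: "0 < T" "0 < K"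
    unfolding T_def K_def using potential_pos kap(1) by auto
  have E: "E = T * \<phi> ^ d" unfolding E_def T_def \<phi>_def d_def ..
  have E0: "0 \<le> E" unfolding E using TK phi by simp
  have R0: "0 < R" unfolding R_def using th d by simp

  \<comment> \<open>\<open>t\<close> bounds each proportion that is given away: the rate in the betting lemma, the deviation
    from the frequency \<open>\<eta>\<close>, the scales lost by mass drops, and the visits to holes.
    Together these cost at most \<open>\<gamma> / 2\<close> per generation, and the other half of \<open>\<gamma>\<close> absorbs the constants.\<close>
  define t where "t = min 1 (\<gamma> / (2 * (1 + 2 * E + K)))"
  have t: "0 < t" "t \<le> 1" "t * (1 + 2 * E + K) \<le> \<gamma> / 2"
  proof -
    have "t \<le> \<gamma> / (2 * (1 + 2 * E + K))" unfolding t_def by simp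
    then have "t * (1 + 2 * E + K) \<le> \<gamma> / (2 * (1 + 2 * E + K)) * (1 + 2 * E + K)"
      using E0 TK by (intro mult_right_mono) auto
    also have "\<dots> = \<gamma> / 2" using E0 TK by (simp add: field_simps)
    finally show "t * (1 + 2 * E + K) \<le> \<gamma> / 2" .
    show "0 < t" "t \<le> 1" unfolding t_def using gam E0 TK by auto
  qed
  define \<Lambda> where "\<Lambda> = real d * ln 2 + 1 + K * (1 + real k)"
  have Lam0: "0 \<le> \<Lambda>" unfolding \<Lambda>_def using TK by simp
  obtain l0 where l0: "(1 / 2) ^ l0 < \<alpha>'" using real_arch_pow_inv[of \<alpha>' "1 / 2"] a by auto
  define \<tau> where "\<tau> = (1 / 2 :: real) ^ l0"
  have tau: "0 < \<tau>" "\<tau> \<le> \<alpha>'" unfolding \<tau>_def using l0 by auto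
  \<comment> \<open>\<open>\<epsilon>1\<close> is the lightness of holes relative to cells and \<open>\<delta>\<close> the ratio of masses of concentric
    balls that counts as a drop, both so small that \<open>count_drops\<close> allows at most the proportion \<open>t\<close>.\<close>
  define \<epsilon>1 where "\<epsilon>1 = exp (- (real k * \<Lambda> / t + 1))"
  define \<delta> where "\<delta> = exp (- (real l0 * (2 * \<Lambda>) / t + 1))"
  define \<epsilon> where "\<epsilon> = \<epsilon>1 * \<delta> / 2"
  have exp_small: "0 < exp (- (u + 1)) \<and> exp (- (u + 1)) < 1" if "0 \<le> u" for u :: real
    using that by simp
  have nonneg: "0 \<le> real k * \<Lambda> / t" "0 \<le> real l0 * (2 * \<Lambda>) / t"
    using Lam0 t by simp_all
  have e1: "0 < \<epsilon>1" "\<epsilon>1 < 1" and del: "0 < \<delta>" "\<delta> < 1"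
    unfolding \<epsilon>1_def \<delta>_def using exp_small[OF nonneg(1)] exp_small[OF nonneg(2)] by blast+
  have eps: "0 < \<epsilon>" "\<epsilon> < 1"
  proof -
    show "0 < \<epsilon>" unfolding \<epsilon>_def using e1 del by simp
    have "\<epsilon>1 * \<delta> \<le> 1 * 1" using e1 del by (intro mult_mono) auto
    then show "\<epsilon> < 1" unfolding \<epsilon>_def by simp
  qed

  define cell where "cell s = grid_cell \<theta> s" for s :: "'a \<Rightarrow> real"
  define hole where "hole s i x \<longleftrightarrow>
    (\<exists>z\<in>cell s i x. measure M (cell s (i + k) z) \<le> \<epsilon>1 * measure M (cell s i x))" for s i x
  have bets: "AE x in M. \<forall>s\<in>S. eventually (\<lambda>n. exp (- \<Lambda> * real n) \<le> measure M (cell s n x) \<and>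
      exp (- (real d * ln 2 + t) * real n + T * real (card {i \<in> {..<n}. hole s i x})
        - K * (real k * \<Lambda> * real (n + k) / ln (1 / \<epsilon>1) + real k)) \<le> measure M (cell s n x)) sequentially"
  proof (subst AE_ball_countable)
    show "countable S" using fin_S by (rule countable_finite)
    show "\<forall>s\<in>S. AE x in M. eventually (\<lambda>n. exp (- \<Lambda> * real n) \<le> measure M (cell s n x) \<and>
      exp (- (real d * ln 2 + t) * real n + T * real (card {i \<in> {..<n}. hole s i x})
        - K * (real k * \<Lambda> * real (n + k) / ln (1 / \<epsilon>1) + real k)) \<le> measure M (cell s n x)) sequentially"
    proof
      fix s assume "s \<in> S"
      interpret partition_tree M "cell s" "2 ^ d"
        unfolding cell_def d_def by (rule partition_tree_grid[OF prob M])
      have D: "real (2 ^ d) = 2 ^ d" "ln (2 ^ d :: real) = real d * ln 2" "1 < (2 :: nat) ^ d"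
        using d one_less_power[of "2 :: nat" d] by (simp_all add: ln_realpow)
      show "AE x in M. eventually (\<lambda>n. exp (- \<Lambda> * real n) \<le> measure M (cell s n x) \<and>
      exp (- (real d * ln 2 + t) * real n + T * real (card {i \<in> {..<n}. hole s i x})
        - K * (real k * \<Lambda> * real (n + k) / ln (1 / \<epsilon>1) + real k)) \<le> measure M (cell s n x)) sequentially"
        unfolding T_def K_def hole_def
      proof (rule light_hole_bet[where k = k and \<Lambda> = \<Lambda>, unfolded D(1,2)])
        show "real d * ln 2 + 1 + potential (1 / 2 ^ d) \<kappa> k k * (1 + real k) \<le> \<Lambda>"
          unfolding \<Lambda>_def K_def ..
      qed (use D(3) kap e1 t in \<open>auto simp: d_def\<close>)
    qed
  qed

  define porous_at where "porous_at i x \<longleftrightarrow> ereal \<alpha> \<le> por M x (1 / 2 ^ i) \<epsilon>" for i x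
  have freq: "AE x in M. ereal \<eta> \<le> liminf (\<lambda>n. ereal (real (card {i \<in> {..<n}. porous_at i x}) / real n))"
    using porous eps unfolding mean_porous_def mean_porous_eps_def porous_at_def by blast

  define drop where "drop i x \<longleftrightarrow> measure M (cball x (1 / 2 ^ (i + l0))) \<le> \<delta> * measure M (cball x (1 / 2 ^ i))" for i x
  have many: "(real N * \<phi>) ^ d \<le> real (card {s \<in> S. hole s i x})"
    if por: "porous_at i x" and dr: "\<not> drop i x" for i x
  proof -
    define r where "r = (1 :: real) / 2 ^ i"
    have r: "0 < r" "r * 2 ^ i = 1" unfolding r_def by simp_all
    have tr: "\<tau> * r = 1 / 2 ^ (i + l0)" unfolding \<tau>_def r_def by (simp add: power_add power_divide)
    obtain y where y: "dist x y + \<alpha>' * r \<le> r"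
        "measure M (cball y (\<alpha>' * r)) \<le> 2 * \<epsilon> * measure M (cball x r)"
      using por_hole[OF prob M por[unfolded porous_at_def] eps(1) _ a(2), folded r_def] a(1) r(1) by auto
    have "\<tau> * r \<le> \<alpha>' * r" "2 * \<tau> * r \<le> 1 * r"
      using tau a r by (auto intro!: mult_right_mono)
    then have "dist x y + \<tau> * r \<le> r" "2 * (\<tau> * r) \<le> r"
      using y(1) by linarith+
    moreover have "0 \<le> \<tau> * r" using tau r by simp
    ultimately have "(real N * (1 - r * 2 ^ i / \<theta>) - 1) ^ DIM('a)
      \<le> real (card {s \<in> shifts N. y \<in> grid_cell \<theta> s i x \<and> cball x (\<tau> * r) \<subseteq> grid_cell \<theta> s i x})"
      using r(2) N(2) by (intro many_shifts N(1) th) simp_all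
    also have "real N * (1 - r * 2 ^ i / \<theta>) - 1 = real N * \<phi>" using r(2) phi(1) by simp
    also have "card {s \<in> shifts N. y \<in> grid_cell \<theta> s i x \<and> cball x (\<tau> * r) \<subseteq> grid_cell \<theta> s i x}
        \<le> card {s \<in> S. hole s i x}"
    proof (intro card_mono subsetI)
      show "finite {s \<in> S. hole s i x}" using fin_S by simp
      fix s assume s: "s \<in> {s \<in> shifts N. y \<in> grid_cell \<theta> s i x \<and> cball x (\<tau> * r) \<subseteq> grid_cell \<theta> s i x}"
      interpret partition_tree M "cell s" "2 ^ d"
        unfolding cell_def d_def by (rule partition_tree_grid[OF prob M])
      have "cell s (i + k) y \<subseteq> cball y (\<alpha>' * r)"
      proof
        fix z assume "z \<in> cell s (i + k) y"
        then have "dist y z \<le> sqrt (real d) * (\<theta> / 2 ^ (i + k))"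
          unfolding cell_def d_def by (rule grid_cell_dist[OF _ th])
        also have "\<dots> = sqrt (real d) * (\<theta> / 2 ^ k) * r"
          unfolding r_def by (simp add: power_add)
        also have "\<dots> \<le> \<alpha>' * r" using size r unfolding d_def by (intro mult_right_mono) auto
        finally show "z \<in> cball y (\<alpha>' * r)" by simp
      qed
      then have "measure M (cell s (i + k) y) \<le> measure M (cball y (\<alpha>' * r))"
        by (intro finite_measure_mono cball_sets)
      also note y(2)
      also have "2 * \<epsilon> * measure M (cball x r) \<le> \<epsilon>1 * measure M (cball x (\<tau> * r))"
      proof -
        have "\<delta> * measure M (cball x r) \<le> measure M (cball x (\<tau> * r))"
          using dr unfolding drop_def r_def[symmetric] tr by simp
        then have "\<epsilon>1 * (\<delta> * measure M (cball x r)) \<le> \<epsilon>1 * measure M (cball x (\<tau> * r))"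
          using e1 by (intro mult_left_mono) auto
        then show ?thesis unfolding \<epsilon>_def by simp
      qed
      also have "\<dots> \<le> \<epsilon>1 * measure M (cell s i x)"
        using s e1 cell_sets[of i x] unfolding cell_def by (intro mult_left_mono finite_measure_mono) auto
      finally show "s \<in> {s \<in> S. hole s i x}" using s unfolding hole_def S_def cell_def by auto
    qed
    finally show ?thesis unfolding d_def by simp
  qed

  have nS: "real (card S) = real N ^ d" "0 < real (card S)"
    unfolding S_def d_def using card_shifts[OF N0, where 'a='a] N0 by auto
  show ?thesis using bets freq
  proof eventually_elim
    case (elim x)
    define P where "P n = real (card {i \<in> {..<n}. porous_at i x})" for n
    define B where "B n = real (card {i \<in> {..<n}. drop i x})" for n
    define H where "H s n = real (card {i \<in> {..<n}. hole s i x})" for s n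
    define m where "m n = measure M (cball x (R / 2 ^ n))" for n
    have cell_ball: "measure M (cell s n x) \<le> m n" for s n
      unfolding m_def
    proof (intro finite_measure_mono cball_sets subsetI)
      fix z assume "z \<in> cell s n x"
      then have "dist x z \<le> sqrt (real d) * (\<theta> / 2 ^ n)"
        unfolding cell_def d_def by (rule grid_cell_dist[OF _ th])
      then show "z \<in> cball x (R / 2 ^ n)" unfolding R_def by simp
    qed
    have all: "eventually (\<lambda>n. \<forall>s\<in>S. exp (- \<Lambda> * real n) \<le> measure M (cell s n x) \<and>
      exp (- (real d * ln 2 + t) * real n + T * H s n
        - K * (real k * \<Lambda> * real (n + k) / ln (1 / \<epsilon>1) + real k)) \<le> measure M (cell s n x)) sequentially"
      using elim(1) unfolding H_def by (subst eventually_ball_finite_distrib[OF fin_S])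
    obtain s0 where s0: "s0 \<in> S" using nS(2) by fastforce
    have P_ev: "eventually (\<lambda>n. P n / real n > \<eta> - t) sequentially"
    proof -
      have "ereal (\<eta> - t) < ereal \<eta>" using t by simp
      also note elim(2)
      finally have "ereal (\<eta> - t) < liminf (\<lambda>n. ereal (real (card {i \<in> {..<n}. porous_at i x}) / real n))" .
      from less_LiminfD[OF this] show ?thesis unfolding P_def by simp
    qed
    have B_ev: "eventually (\<lambda>n. B n \<le> t * real (n + l0)) sequentially"
    proof -
      obtain n0 where n0: "\<And>n. n0 \<le> n \<Longrightarrow> exp (- \<Lambda> * real n) \<le> m n"
        using all s0 cell_ball unfolding eventually_sequentially by (meson order_trans)
      obtain q :: nat where q: "R < 2 ^ q" using real_arch_pow[of 2 R] by auto
      have low: "exp (- (2 * \<Lambda>) * real n) \<le> measure M (cball x (1 / 2 ^ n))" if "max n0 q \<le> n" for n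
      proof -
        have "exp (- (2 * \<Lambda>) * real n) \<le> exp (- \<Lambda> * real (n + q))"
          using that mult_left_mono[of "real (n + q)" "2 * real n" \<Lambda>] Lam0 by simp
        also have "\<dots> \<le> m (n + q)" using that by (intro n0) simp
        also have "\<dots> \<le> measure M (cball x (1 / 2 ^ n))"
          unfolding m_def using q
          by (intro finite_measure_mono cball_sets subset_cball) (simp add: power_add field_simps)
        finally show ?thesis .
      qed
      have "B n \<le> t * real (n + l0)" if n: "max n0 q \<le> n" for n
      proof -
        have "B n * ln (1 / \<delta>) \<le> real l0 * (2 * \<Lambda>) * real (n + l0)"
          unfolding B_def drop_def
        proof (rule count_drops[OF _ _ low n del])
          show "measure M (cball x (1 / 2 ^ Suc n)) \<le> measure M (cball x (1 / 2 ^ n))" for n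
            by (intro finite_measure_mono cball_sets subset_cball) (simp add: field_simps)
        qed (use Lam0 in auto)
        also have "\<dots> \<le> t * ln (1 / \<delta>) * real (n + l0)"
          using t unfolding \<delta>_def by (intro mult_right_mono) (auto simp: ln_div field_simps)
        finally have "B n * ln (1 / \<delta>) \<le> t * real (n + l0) * ln (1 / \<delta>)" by (simp add: mult_ac)
        moreover have "0 < ln (1 / \<delta>)" using del by simp
        ultimately show ?thesis by (simp add: mult_le_cancel_right)
      qed
      then show ?thesis unfolding eventually_sequentially by blast
    qed
    define C where "C = E * (t * real l0) + K * (t * real k + real k)"
    obtain n3 :: nat where n3: "C / (\<gamma> / 2) < real n3" using reals_Archimedean2 by blast
    have "eventually (\<lambda>n. exp (- (real d * ln 2 - E * \<eta> + \<gamma>) * real n) \<le> m n) sequentially"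
      using P_ev B_ev all eventually_ge_at_top[of "max 1 n3"]
    proof eventually_elim
      case (elim n)
      have n: "0 < real n" "C \<le> \<gamma> / 2 * real n"
      proof -
        show "0 < real n" using elim(4) by simp
        have "C \<le> \<gamma> / 2 * real n3" using n3 gam by (simp add: divide_less_eq mult.commute)
        also have "\<dots> \<le> \<gamma> / 2 * real n" using elim(4) gam by (intro mult_left_mono) auto
        finally show "C \<le> \<gamma> / 2 * real n" .
      qed
      have Pn: "(\<eta> - t) * real n \<le> P n" using elim(1) n by (simp add: less_divide_eq)
      have holes: "(real N * \<phi>) ^ d * (P n - B n) \<le> (\<Sum>s\<in>S. H s n)"
      proof -
        have "card {i \<in> {..<n}. porous_at i x} \<le> card ({i \<in> {..<n}. porous_at i x \<and> \<not> drop i x} \<union> {i \<in> {..<n}. drop i x})"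
          by (rule card_mono) auto
        also have "\<dots> \<le> card {i \<in> {..<n}. porous_at i x \<and> \<not> drop i x} + card {i \<in> {..<n}. drop i x}"
          by (rule card_Un_le)
        finally have "P n - B n \<le> real (card {i \<in> {..<n}. porous_at i x \<and> \<not> drop i x})"
          unfolding P_def B_def by simp
        then have "(real N * \<phi>) ^ d * (P n - B n)
            \<le> (real N * \<phi>) ^ d * real (card {i \<in> {..<n}. porous_at i x \<and> \<not> drop i x})"
          using phi by (intro mult_left_mono) auto
        also have "\<dots> = (\<Sum>i<n. if porous_at i x \<and> \<not> drop i x then (real N * \<phi>) ^ d else 0)"
          by (simp add: sum_if_const)
        also have "\<dots> \<le> (\<Sum>i<n. real (card {s \<in> S. hole s i x}))"
          using many by (intro sum_mono) auto
        also have "\<dots> = (\<Sum>i<n. \<Sum>s\<in>S. if hole s i x then 1 else 0)"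
          using fin_S by (simp add: sum_if_const)
        also have "\<dots> = (\<Sum>s\<in>S. \<Sum>i<n. if hole s i x then 1 else 0)" by (rule sum.swap)
        also have "\<dots> = (\<Sum>s\<in>S. H s n)" unfolding H_def by (simp add: sum_if_const)
        finally show ?thesis .
      qed
      have m_pos: "0 < m n"
        using elim(3) s0 cell_ball[of s0 n] exp_gt_zero by (meson less_le_trans)
      define X where "X = (real d * ln 2 + t) * real n + K * (t * real (n + k) + real k)"
      have each: "T * H s n - X \<le> ln (m n)" if "s \<in> S" for s
      proof -
        have "real k * \<Lambda> * real (n + k) / ln (1 / \<epsilon>1) \<le> t * real (n + k)"
        proof -
          have ln0: "0 < ln (1 / \<epsilon>1)" using e1 by simp
          have "real k * \<Lambda> \<le> t * ln (1 / \<epsilon>1)"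
            using t unfolding \<epsilon>1_def by (simp add: ln_div field_simps)
          then have "real k * \<Lambda> * real (n + k) \<le> t * ln (1 / \<epsilon>1) * real (n + k)"
            by (rule mult_right_mono) simp
          then show ?thesis using ln0 by (simp add: pos_divide_le_eq mult_ac)
        qed
        then have "K * (real k * \<Lambda> * real (n + k) / ln (1 / \<epsilon>1) + real k) \<le> K * (t * real (n + k) + real k)"
          using TK by (intro mult_left_mono add_right_mono) auto
        then have "T * H s n - X \<le> - (real d * ln 2 + t) * real n + T * H s n
          - K * (real k * \<Lambda> * real (n + k) / ln (1 / \<epsilon>1) + real k)"
          unfolding X_def mult_minus_left by linarith
        moreover have "exp \<dots> \<le> m n" using elim(3) that cell_ball[of s n] by (meson order_trans)
        ultimately have "exp (T * H s n - X) \<le> m n" by (meson exp_le_cancel_iff order_trans)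
        then show ?thesis using m_pos by (simp add: ln_ge_iff)
      qed
      have "real (card S) * (E * (P n - B n) - X) = T * ((real N * \<phi>) ^ d * (P n - B n)) - real (card S) * X"
        unfolding E nS by (simp add: power_mult_distrib algebra_simps)
      also have "\<dots> \<le> T * (\<Sum>s\<in>S. H s n) - real (card S) * X"
        using holes TK by (intro diff_right_mono mult_left_mono) auto
      also have "\<dots> = (\<Sum>s\<in>S. T * H s n - X)" by (simp add: sum_subtractf sum_distrib_left)
      also have "\<dots> \<le> (\<Sum>s\<in>S. ln (m n))" by (intro sum_mono each)
      also have "\<dots> = real (card S) * ln (m n)" by simp
      finally have avg: "E * (P n - B n) - X \<le> ln (m n)" using nS(2) by (simp add: mult_le_cancel_left)
      have "E * ((\<eta> - t) * real n - t * real (n + l0)) \<le> E * (P n - B n)"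
        using Pn elim(2) E0 by (intro mult_left_mono) auto
      moreover have "t * (1 + 2 * E + K) * real n \<le> \<gamma> / 2 * real n" using t(3) by (intro mult_right_mono) auto
      ultimately have "- (real d * ln 2 - E * \<eta> + \<gamma>) * real n \<le> ln (m n)"
        using avg n(2) unfolding X_def C_def by (simp add: algebra_simps)
      then show ?case using m_pos by (simp add: ln_ge_iff)
    qed
    then show ?case unfolding m_def R_def d_def by simp
  qed
qed

text \<open>
  The number 221/1000 is \<open>2 / 9\<close>, reduced to make room for \<open>\<alpha>'\<close> and \<open>N = 1001\<close> below. For
  \<open>d = 1\<close> the two sides are 0.025 and about 0.02528.
\<close>
lemma deficit_constant:
  fixes d :: nat
  defines "p \<equiv> 1 / 2 ^ d :: real"
  assumes d: "1 \<le> d"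
  obtains \<kappa> where "0 < \<kappa>"
    and "\<And>v. 0 \<le> v \<Longrightarrow> p * v / (1 + \<kappa> * v) \<le> - ln (1 - p + p * exp (- v))"
    and "2 / 5 / 16 ^ d < (1 - sqrt p)\<^sup>2 / \<kappa> * (221 / 1000) ^ d"
proof (cases "d = 1")
  case True
  then have p: "p = 1 / 2" unfolding p_def by simp
  have "sqrt p \<le> 70711 / 100000" unfolding p by (rule real_le_lsqrt) (simp_all add: power2_eq_square)
  then have "(29289 / 100000)\<^sup>2 \<le> (1 - sqrt p)\<^sup>2" by (intro power_mono) auto
  then have "2 / 5 / 16 ^ d < (1 - sqrt p)\<^sup>2 / (3 / 4) * (221 / 1000) ^ d"
    using True by (simp add: power2_eq_square)
  moreover have "p * v / (1 + 3 / 4 * v) \<le> - ln (1 - p + p * exp (- v))" if "0 \<le> v" for v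
    unfolding p using profit_half_ge[OF that] .
  ultimately show ?thesis by (intro that[of "3 / 4"]) simp_all
next
  case False
  then have d2: "2 \<le> d" using d by simp
  have "(2 :: real) ^ 2 \<le> 2 ^ d" using d2 by (intro power_increasing) auto
  then have p: "0 < p" "p \<le> 1 / 4" unfolding p_def by (auto simp: field_simps)
  have "sqrt p \<le> 1 / 2" by (rule real_le_lsqrt) (use p in \<open>auto simp: power2_eq_square\<close>)
  then have "(1 / 2)\<^sup>2 \<le> (1 - sqrt p)\<^sup>2" by (intro power_mono) auto
  then have sq: "1 / 4 \<le> (1 - sqrt p)\<^sup>2" by (simp add: power2_eq_square)
  have "(2 / 5) * (1 / 16) ^ d < 1 / 4 * ((442 / 125) ^ 1 * (1 / 16 :: real) ^ d)" by simp
  also have "\<dots> \<le> 1 / 4 * ((442 / 125) ^ d * (1 / 16) ^ d)"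
    using d by (intro mult_left_mono mult_right_mono power_increasing) auto
  also have "(442 / 125 :: real) ^ d * (1 / 16) ^ d = (221 / 1000) ^ d"
    unfolding power_mult_distrib[symmetric] by simp
  also have "1 / 4 * (221 / 1000) ^ d \<le> (1 - sqrt p)\<^sup>2 * (221 / 1000 :: real) ^ d"
    using sq by (rule mult_right_mono) simp
  finally have "2 / 5 / 16 ^ d < (1 - sqrt p)\<^sup>2 / 1 * (221 / 1000) ^ d"
    by (simp add: power_one_over)
  then show ?thesis using profit_ge[of p] p by (intro that[of 1]) auto
qed

text \<open>
  Choosing \<open>\<theta> = 2 ^ k * x\<close> between \<open>3 / 2\<close> and 3 makes the holes as large as possible, without
  rounding, and keeps \<open>W = 1 / \<theta>\<close> between \<open>1 / 3\<close> and \<open>2 / 3\<close>. On this interval, whose ends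
  have ratio 2, \<open>W * (1 - W)\<close> takes its least value \<open>2 / 9\<close> at both ends, and the summand
  \<open>1 / 1001\<close> costs at most \<open>2 / 3003\<close>.
\<close>
lemma grid_parameters:
  fixes x :: real
  assumes x: "0 < x" "x \<le> 1"
  obtains k :: nat and \<theta> :: real where "3 / 2 \<le> \<theta>" and "\<theta> / 2 ^ k = x"
    and "443 / 2000 * x \<le> 1 / 2 ^ k * (1 - 1 / \<theta> - 1 / 1001)"
proof -
  have "\<exists>k. 3 / 2 \<le> 2 ^ k * x"
  proof -
    obtain k where "3 / 2 / x < 2 ^ k" using real_arch_pow[of 2 "3 / 2 / x"] by auto
    then show ?thesis using x by (intro exI[of _ k]) (simp add: field_simps)
  qed
  then obtain k where k: "3 / 2 \<le> 2 ^ k * x" "\<And>l. l < k \<Longrightarrow> 2 ^ l * x < 3 / 2"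
    using exists_least_iff[of "\<lambda>k. 3 / 2 \<le> 2 ^ k * x"] by (auto simp: not_le)
  have "k \<noteq> 0" using k(1) x by (cases k) auto
  then have "2 ^ (k - 1) * x < 3 / 2" "(2 :: real) ^ k = 2 * 2 ^ (k - 1)"
    using k(2)[of "k - 1"] by (auto simp: power_Suc[symmetric] simp del: power_Suc)
  then have k3: "2 ^ k * x \<le> 3" by simp
  define \<theta> where "\<theta> = 2 ^ k * x"
  define W where "W = 1 / \<theta>"
  have th: "3 / 2 \<le> \<theta>" "\<theta> \<le> 3" using k k3 unfolding \<theta>_def by auto
  have W: "1 / 3 \<le> W" "W \<le> 2 / 3" unfolding W_def using th by (auto simp: field_simps)
  have "0 \<le> (W - 1 / 3) * (2 / 3 - W)" using W by simp
  moreover have "(W - 1 / 3) * (2 / 3 - W) = W - 2 / 9 - W * W" by (simp add: field_simps)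
  ultimately have "W * W \<le> W - 2 / 9" by linarith
  moreover have "W * (1 - W - 1 / 1001) = 1000 / 1001 * W - W * W" by (simp add: algebra_simps)
  ultimately have "443 / 2000 \<le> W * (1 - W - 1 / 1001)" using W by linarith
  then have "443 / 2000 * x \<le> x * (W * (1 - W - 1 / 1001))" using x by (simp add: mult.commute)
  also have "\<dots> = 1 / 2 ^ k * (1 - 1 / \<theta> - 1 / 1001)"
    unfolding W_def \<theta>_def using x by simp
  finally show ?thesis using th(1) by (intro that[of \<theta> k]) (auto simp: \<theta>_def)
qed

theorem theorem1p1:
  fixes \<mu> :: "'a::euclidean_space measure" and \<alpha> \<eta> :: real
  assumes "0 < \<alpha>" and "\<alpha> \<le> 1 / 2" and "0 < \<eta>" and "\<eta> \<le> 1"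
    and "prob_space \<mu>" and "sets \<mu> = sets borel"
    and "mean_porous \<alpha> \<eta> \<mu>"
  shows "packing_dim \<mu> \<le> ereal (real DIM('a) - porosity_const DIM('a) * \<eta> * \<alpha> ^ DIM('a))"
proof -
  define d where "d = DIM('a)"
  define p :: real where "p = 1 / 2 ^ d"
  have d: "1 \<le> d" unfolding d_def by (simp add: Suc_leI)
  obtain \<kappa> where kap: "0 < \<kappa>"
      "\<And>v. 0 \<le> v \<Longrightarrow> p * v / (1 + \<kappa> * v) \<le> - ln (1 - p + p * exp (- v))"
      "2 / 5 / 16 ^ d < (1 - sqrt p)\<^sup>2 / \<kappa> * (221 / 1000) ^ d"
    using deficit_constant[OF d] unfolding p_def by metis
  \<comment> \<open>Porosity gives holes of relative radius strictly below \<open>\<alpha>\<close> only; this and \<open>N = 1001\<close> are covered by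
    the difference between \<open>2 / 9\<close> and 221/1000.\<close>
  define \<alpha>' where "\<alpha>' = 999 / 1000 * \<alpha>"
  have a: "0 < \<alpha>'" "\<alpha>' < \<alpha>" using assms(1) unfolding \<alpha>'_def by auto
  have sqrt_d: "1 \<le> sqrt (real d)" using d by simp
  have x_pos: "0 < \<alpha>' / sqrt (real d)" using a d by simp
  have "\<alpha>' \<le> sqrt (real d)" using a assms(2) sqrt_d by linarith
  then have "\<alpha>' / sqrt (real d) \<le> 1" using d by (simp add: divide_le_eq)
  then obtain k :: nat and \<theta> where th: "3 / 2 \<le> \<theta>" "\<theta> / 2 ^ k = \<alpha>' / sqrt (real d)"
      "443 / 2000 * (\<alpha>' / sqrt (real d)) \<le> 1 / 2 ^ k * (1 - 1 / \<theta> - 1 / 1001)"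
    using grid_parameters[of "\<alpha>' / sqrt (real d)"] x_pos by blast
  define E where "E = potential p \<kappa> k 0 * (1 - 1 / \<theta> - 1 / real 1001) ^ d"
  have "1 < (2 :: real) ^ d" using d one_less_power[of "2 :: real" d] by simp
  then have p: "0 < p" "p < 1" unfolding p_def by auto
  have E: "porosity_const d * ln 2 * \<alpha> ^ d < E"
  proof -
    have "sqrt (real d) ^ d = real d powr (real d / 2)"
      using d by (simp add: powr_half_sqrt[symmetric] powr_realpow[symmetric] powr_powr)
    then have "porosity_const d * ln 2 * \<alpha> ^ d = 2 / 5 / 16 ^ d * (\<alpha> / sqrt (real d)) ^ d"
      unfolding porosity_const_def by (simp add: power_mult power_divide)
    also have "\<dots> < (1 - sqrt p)\<^sup>2 / \<kappa> * (221 / 1000) ^ d * (\<alpha> / sqrt (real d)) ^ d"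
      using kap(3) assms(1) sqrt_d by (intro mult_strict_right_mono) auto
    also have "\<dots> = (1 - sqrt p)\<^sup>2 / \<kappa> * (221 / 1000 * (\<alpha> / sqrt (real d))) ^ d"
      by (simp only: power_mult_distrib mult.assoc)
    also have "\<dots> \<le> (1 - sqrt p)\<^sup>2 / \<kappa> * (1 / 2 ^ k * (1 - 1 / \<theta> - 1 / 1001)) ^ d"
    proof (intro mult_left_mono power_mono)
      have "221 / 1000 * (\<alpha> / sqrt (real d)) \<le> 443 / 2000 * (\<alpha>' / sqrt (real d))"
        unfolding \<alpha>'_def using assms(1) sqrt_d by (simp add: field_simps)
      then show "221 / 1000 * (\<alpha> / sqrt (real d)) \<le> 1 / 2 ^ k * (1 - 1 / \<theta> - 1 / 1001)"
        using th(3) by linarith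
    qed (use kap(1) assms(1) in auto)
    also have "\<dots> = E"
    proof -
      have "(1 / 2 ^ k :: real) ^ d = p ^ k"
        unfolding p_def by (simp add: power_divide power_mult[symmetric] mult.commute)
      then show ?thesis
        unfolding E_def potential_start[OF p kap(1)] power_mult_distrib by simp
    qed
    finally show ?thesis .
  qed
  \<comment> \<open>Half of the strict gain over the required constant is left for the error term.\<close>
  define \<gamma> where "\<gamma> = (E - porosity_const d * ln 2 * \<alpha> ^ d) * \<eta> / 2"
  have gam: "0 < \<gamma>" unfolding \<gamma>_def using E assms(3) by simp
  define c where "c = real d - porosity_const d * \<eta> * \<alpha> ^ d"
  define \<xi> where "\<xi> = real d * ln 2 - E * \<eta> + \<gamma>"
  have xi: "\<xi> / ln 2 < c"
  proof -
    have "\<xi> = real d * ln 2 - porosity_const d * ln 2 * \<alpha> ^ d * \<eta> - \<gamma>"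
      unfolding \<xi>_def \<gamma>_def by (simp add: field_simps)
    then have "\<xi> < c * ln 2" unfolding c_def using gam by (simp add: algebra_simps)
    then show ?thesis by (simp add: divide_less_eq)
  qed
  have "AE x in \<mu>. eventually (\<lambda>n. exp (- \<xi> * real n)
      \<le> measure \<mu> (cball x (sqrt (real d) * (\<theta> / 2 ^ n)))) sequentially"
    unfolding \<xi>_def E_def p_def d_def
  proof (rule mass_lower_bound[OF assms(5,6,7) a assms(2) _ _ _ _ kap(1)])
    show "0 < \<theta>" using th(1) by simp
    show "odd (1001 :: nat)" by simp
    have "1 / \<theta> \<le> 2 / 3" using th(1) by (simp add: field_simps)
    then show "0 \<le> real 1001 * (1 - 1 / \<theta>) - 1" by simp
    show "sqrt (real DIM('a)) * (\<theta> / 2 ^ k) \<le> \<alpha>'"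
      using th(2) sqrt_d unfolding d_def by simp
  qed (use kap(2) gam in \<open>auto simp: p_def d_def\<close>)
  then have "AE x in \<mu>. upper_local_dim \<mu> x \<le> ereal c"
  proof (rule AE_mp, intro AE_I2 impI)
    fix x assume "eventually (\<lambda>n. exp (- \<xi> * real n)
      \<le> measure \<mu> (cball x (sqrt (real d) * (\<theta> / 2 ^ n)))) sequentially"
    then show "upper_local_dim \<mu> x \<le> ereal c"
      using th(1) sqrt_d
      by (intro upper_local_dim_le[OF assms(5,6) _ xi, of "sqrt (real d) * \<theta>"]) auto
  qed
  then have "packing_dim \<mu> \<le> ereal c"
    unfolding packing_dim_def by (intro esssup_I measurable_upper_local_dim assms)
  then show ?thesis unfolding c_def d_def .
qed

end
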